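(* Let $K$ be a field, $R=K[x_1,\ldots,x_n]$, $\mathfrak m=(x_1,\ldots,x_n)$, and let $I\subseteq R$ be a polymatroidal ideal of degree $d$ with $\mathrm{supp}(I)=\{x_1,\ldots,x_n\}$. Then $I$ is unmixed if and only if one of the following conditions holds: (1) $I=\mathfrak m^d$. (2) $I=\mathfrak p_1^{a_1}\mathfrak p_2^{a_2}\cdots\mathfrak p_t^{a_t}$ for some $t\ge 1$ and integers $a_i\ge 1$, where the $\mathfrak p_i$ are monomial prime ideals with $\mathrm{height}(\mathfrak p_i)=\mathrm{height}(\mathfrak p_j)$ and $G(\mathfrak p_i)\cap G(\mathfrak p_j)=\emptyset$ for all $1\le i\ne j\le t$, and $\sum_{i=1}^t a_i=d$. (3) $I=\mathfrak p_1^{a_1}\mathfrak p_2^{a_2}\cdots\mathfrak p_t^{a_t}J$ for some $t\ge 1$ and integers $a_i\ge 1$, where the $\mathfrak p_i$ are monomial prime ideals and $J$ is an unmixed matroidal ideal such that $\mathrm{height}(\mathfrak p_i)=\mathrm{height}(J)$ for all $1\le i\le t$, $G(\mathfrak p_i)\cap G(\mathfrak p_j)=\emptyset$ for all $1\le i\ne j\le t$, $G(\mathfrak p_i)\cap \mathrm{supp}(J)=\emptyset$ for all $1\le i\le t$, and $\sum_{i=1}^t a_i+\deg(J)=d$. (4) $I$ is an unmixed matroidal ideal of degree $d$.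
   Context: For a monomial ideal $I$ of $R$, $G(I)$ denotes its unique minimal set of monomial generators, and $\mathrm{supp}(I)$ denotes the set of variables that divide at least one element of $G(I)$. A monomial ideal $I$ generated in a single degree $d$ is polymatroidal of degree $d$ if for all $u,v\in G(I)$ and every $i$ with $\deg_{x_i}(v)<\deg_{x_i}(u)$ there is an index $j$ with $\deg_{x_j}(u)<\deg_{x_j}(v)$ and $x_j(u/x_i)\in G(I)$. It is matroidal if moreover it is generated by squarefree monomials; $\deg(J)$ denotes the common degree of the generators of a matroidal ideal $J$ (here $J$ is an ideal of $R$ which need not involve all the variables). An ideal is unmixed if all its associated primes (the associated primes of the quotient of $R$ by it) have the same height. A monomial prime ideal is an ideal generated by a nonempty set of variables; for such a $\mathfrak p$, $G(\mathfrak p)$ is this set of variables. *)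

theory Defs
  imports
    "HOL-Library.Poly_Mapping"
    "HOL-Library.Extended_Nat"
    "HOL-Algebra.Ideal_Product"
    "HOL-Algebra.Algebraic_Closure_Type"
begin

section \<open>Heights, associated primes and unmixed ideals\<close>

definition prime_height :: "('a, 'b) ring_scheme \<Rightarrow> 'a set \<Rightarrow> enat" where
  "prime_height R P =
     Sup {enat r | r. \<exists>Q. (\<forall>i\<le>r. primeideal (Q i) R) \<and> (\<forall>i<r. Q i \<subset> Q (Suc i)) \<and> Q r = P}"

text \<open>The unit ideal lies in no prime ideal, so its height is \<open>\<infinity>\<close>.\<close>

definition ideal_height :: "('a, 'b) ring_scheme \<Rightarrow> 'a set \<Rightarrow> enat" where
  "ideal_height R I = (INF P \<in> {P. primeideal P R \<and> I \<subseteq> P}. prime_height R P)"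

text \<open>The annihilator of the residue class of \<open>f\<close> in \<open>R/I\<close> is the set of all \<open>r\<close> with
  \<open>r f \<in> I\<close>; an associated prime of \<open>R/I\<close> is a prime ideal of this form.\<close>

definition associated_primes :: "('a, 'b) ring_scheme \<Rightarrow> 'a set \<Rightarrow> 'a set set" where
  "associated_primes R I =
     {P. primeideal P R \<and> (\<exists>f \<in> carrier R. P = {r \<in> carrier R. r \<otimes>\<^bsub>R\<^esub> f \<in> I})}"

definition unmixed :: "('a, 'b) ring_scheme \<Rightarrow> 'a set \<Rightarrow> bool" where
  "unmixed R I \<longleftrightarrow>
     (\<forall>P \<in> associated_primes R I. \<forall>Q \<in> associated_primes R I. ideal_height R P = ideal_height R Q)"

section \<open>Monomial ideals\<close>

text \<open>The variables are indexed by a finite type \<open>'n\<close>, so their number is \<open>CARD('n) \<ge> 1\<close>.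
  Monomials are represented by their exponent vectors, of type \<open>'n \<Rightarrow>\<^sub>0 nat\<close>, so that
  \<open>lookup u i\<close> is the degree of \<open>u\<close> in the \<open>i\<close>-th variable; sets of variables are
  represented by sets of indices.\<close>

type_synonym ('n, 'k) mpoly = "('n \<Rightarrow>\<^sub>0 nat) \<Rightarrow>\<^sub>0 'k"

abbreviation mpoly_ring :: "('n, 'k::field) mpoly ring" where
  "mpoly_ring \<equiv> ring_of_type_algebra"

definition xmon :: "('n \<Rightarrow>\<^sub>0 nat) \<Rightarrow> ('n, 'k::field) mpoly" where
  "xmon u = Poly_Mapping.single u 1"

definition monomial_span :: "('n \<Rightarrow>\<^sub>0 nat) set \<Rightarrow> ('n, 'k::field) mpoly set" where
  "monomial_span S = Idl\<^bsub>mpoly_ring\<^esub> (xmon ` S)"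

definition monomial_ideal :: "('n, 'k::field) mpoly set \<Rightarrow> bool" where
  "monomial_ideal I \<longleftrightarrow> (\<exists>S. I = monomial_span S)"

text \<open>Meaningful for monomial ideals only, for which the minimal set of monomial generators
  exists and is unique.\<close>

definition min_gens :: "('n, 'k::field) mpoly set \<Rightarrow> ('n \<Rightarrow>\<^sub>0 nat) set" where
  "min_gens I = (THE S. monomial_span S = I \<and> (\<forall>T. T \<subset> S \<longrightarrow> monomial_span T \<noteq> I))"

definition ideal_supp :: "('n, 'k::field) mpoly set \<Rightarrow> 'n set" where
  "ideal_supp I = {i. \<exists>u \<in> min_gens I. 0 < Poly_Mapping.lookup u i}"

definition mono_degree :: "('n::finite \<Rightarrow>\<^sub>0 nat) \<Rightarrow> nat" where
  "mono_degree u = (\<Sum>i\<in>UNIV. Poly_Mapping.lookup u i)"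

text \<open>The zero ideal, which has no generators and hence no degree, is excluded.\<close>

definition polymatroidal :: "nat \<Rightarrow> ('n::finite, 'k::field) mpoly set \<Rightarrow> bool" where
  "polymatroidal d I \<longleftrightarrow>
     monomial_ideal I \<and> min_gens I \<noteq> {} \<and> (\<forall>u \<in> min_gens I. mono_degree u = d) \<and>
     (\<forall>u \<in> min_gens I. \<forall>v \<in> min_gens I. \<forall>i. Poly_Mapping.lookup v i < Poly_Mapping.lookup u i \<longrightarrow>
        (\<exists>j. Poly_Mapping.lookup u j < Poly_Mapping.lookup v j \<and>
             u - Poly_Mapping.single i 1 + Poly_Mapping.single j 1 \<in> min_gens I))"

definition matroidal :: "nat \<Rightarrow> ('n::finite, 'k::field) mpoly set \<Rightarrow> bool" where
  "matroidal d I \<longleftrightarrow> polymatroidal d I \<and> (\<forall>u \<in> min_gens I. \<forall>i. Poly_Mapping.lookup u i \<le> 1)"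

text \<open>The ideal generated by the variables in \<open>A\<close>. For nonempty \<open>A\<close> these are the monomial
  prime ideals, and \<open>A\<close> is the set of minimal generators.\<close>

definition var_ideal :: "'n set \<Rightarrow> ('n, 'k::field) mpoly set" where
  "var_ideal A = monomial_span ((\<lambda>i. Poly_Mapping.single i 1) ` A)"

definition var_ideal_power_prod ::
    "nat \<Rightarrow> (nat \<Rightarrow> 'n set) \<Rightarrow> (nat \<Rightarrow> nat) \<Rightarrow> ('n, 'k::field) mpoly set" where
  "var_ideal_power_prod t A a =
     (\<Otimes>\<^bsub>ideals_set mpoly_ring\<^esub> i \<in> {1..t}. var_ideal (A i) [^]\<^bsub>ideals_set mpoly_ring\<^esub> a i)"

end

theory Submission
  imports Defs
begin

text \<open>Let \<open>B\<close> be the set of exponent vectors of the minimal generators of \<open>I\<close>. A set \<open>C\<close> of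
variables with \<open>I \<subseteq> P\<^sub>C\<close>, where \<open>P\<^sub>C\<close> is the ideal generated by \<open>C\<close>, is a cover of
\<open>B\<close>: every \<open>v \<in> B\<close> has positive degree in the variables of \<open>C\<close>. The minimal covers give
associated primes of \<open>I\<close>, and every monomial outside \<open>I\<close> has a multiple \<open>w\<close> outside \<open>I\<close>
such that \<open>I : w\<close> is some \<open>P\<^sub>A\<close>. A strict inclusion of primes increases the (finite)
height, so in an unmixed ideal each such \<open>A\<close> is a minimal cover. Write \<open>r\<^sub>C\<close> for the smallest
degree that an element of \<open>B\<close> has in \<open>C\<close>. Exchanging one base against another shows that a
base of degree \<open>r\<^sub>C\<close> in a minimal cover \<open>C\<close> may have its part in \<open>C\<close> replaced by any other
monomial in \<open>C\<close> of that degree. Hence an unmixed polymatroidal ideal is the intersection of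
the powers \<open>P\<^sub>C ^ r\<^sub>C\<close> over the minimal covers \<open>C\<close>
(\<open>unmixed_imp_saturated\<close>).

The heart of the proof is that a heavy minimal cover, one with \<open>r\<^sub>C \<ge> 2\<close>, is disjoint from
every other minimal cover (\<open>heavy_min_cover_disjoint\<close>). If some \<open>C'\<close> meets \<open>C\<close>, take one with
\<open>D = C \<union> C'\<close> as small as possible. The bases of least degree \<open>r\<close> in \<open>D\<close> can have any
monomial of degree \<open>r\<^sub>C\<close> in \<open>C\<close>, and dividing one of them by a variable of \<open>D - C\<close>
leaves the ideal, even if the exponents outside \<open>D\<close> are raised, because the degree in \<open>D\<close> falls
below \<open>r\<close>. So for each monomial \<open>m\<close> of degree
\<open>r\<^sub>C\<close> in \<open>C\<close> there is a minimal cover inside \<open>D\<close>, other than \<open>C\<close>, which avoids \<open>m\<close>. As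
\<open>r\<^sub>C \<ge> 2\<close>, this can be applied first to a power of a variable \<open>s\<close>, and then to a monomial
in which both \<open>s\<close> and a variable \<open>t\<close> of the first cover occur. A single exchange inside the first
cover then produces a base whose degree in the second cover is too small.

Thus the heavy covers split off: \<open>I\<close> is the product of the powers \<open>P\<^sub>C ^ r\<^sub>C\<close> over the heavy
covers, in disjoint sets of variables, and of the intersection \<open>J\<close> of the remaining primes. The
ideal \<open>J\<close> is squarefree, and exchange for \<open>B\<close> gives exchange for its generators
(\<open>split_off_heavy\<close>). According to whether there are heavy or light covers, this is one of the
last three forms in the theorem; the first is the special case of a single prime.

Conversely, products in disjoint sets of variables are intersections. A prime \<open>I : f\<close> of a finite
intersection is one of the colon ideals of the intersected ideals, and the powers of \<open>P\<^sub>C\<close> are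
primary, so that each of the products has only the evident associated primes. The height of a prime
is finite because polynomials chosen along a chain of primes, one from each step, are algebraically
independent, while the number of monomials of bounded exponents limits how many polynomials can be
algebraically independent (\<open>prime_chain_length\<close>).\<close>

section \<open>Monomials and divisibility\<close>

abbreviation expo :: "('n \<Rightarrow>\<^sub>0 nat) \<Rightarrow> 'n \<Rightarrow> nat" where
  "expo \<equiv> Poly_Mapping.lookup"

abbreviation var :: "'n \<Rightarrow> ('n \<Rightarrow>\<^sub>0 nat)" where
  "var i \<equiv> Poly_Mapping.single i 1"

definition mono_dvd :: "('n \<Rightarrow>\<^sub>0 nat) \<Rightarrow> ('n \<Rightarrow>\<^sub>0 nat) \<Rightarrow> bool" where
  "mono_dvd u v \<longleftrightarrow> (\<forall>i. expo u i \<le> expo v i)"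

definition multiples :: "('n \<Rightarrow>\<^sub>0 nat) set \<Rightarrow> ('n \<Rightarrow>\<^sub>0 nat) set" where
  "multiples B = {w. \<exists>v\<in>B. mono_dvd v w}"

definition upclosed :: "('n \<Rightarrow>\<^sub>0 nat) set \<Rightarrow> bool" where
  "upclosed U \<longleftrightarrow> (\<forall>u\<in>U. \<forall>v. u + v \<in> U)"

text \<open>Every monomial ideal has the form \<open>polys_on U\<close> for a unique up-closed set \<open>U\<close>. In this
form products, intersections and colons by monomials become operations on sets of exponents.\<close>

definition polys_on :: "('n \<Rightarrow>\<^sub>0 nat) set \<Rightarrow> ('n, 'k::field) mpoly set" where
  "polys_on U = {f. Poly_Mapping.keys f \<subseteq> U}"

definition partial_degree :: "'n::finite set \<Rightarrow> ('n \<Rightarrow>\<^sub>0 nat) \<Rightarrow> nat" where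
  "partial_degree A u = (\<Sum>i\<in>A. expo u i)"

definition mon_of :: "('n::finite \<Rightarrow> nat) \<Rightarrow> ('n \<Rightarrow>\<^sub>0 nat)" where
  "mon_of e = Abs_poly_mapping e"

lemma expo_mon_of [simp]: "expo (mon_of e) i = e i"
  by (simp add: mon_of_def)

lemma mono_dvd_refl [simp]: "mono_dvd u u"
  by (simp add: mono_dvd_def)

lemma mono_dvd_trans: "mono_dvd u v \<Longrightarrow> mono_dvd v w \<Longrightarrow> mono_dvd u w"
  unfolding mono_dvd_def using le_trans by blast

lemma mono_dvd_antisym: "mono_dvd u v \<Longrightarrow> mono_dvd v u \<Longrightarrow> u = v"
  unfolding mono_dvd_def by (intro poly_mapping_eqI antisym) auto

lemma mono_dvd_add [simp]: "mono_dvd u (u + v)"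
  by (simp add: mono_dvd_def lookup_add)

lemma mono_dvd_iff_add: "mono_dvd u v \<longleftrightarrow> (\<exists>w. v = u + w)"
proof
  assume "mono_dvd u v"
  then have "v = u + (v - u)"
    by (intro poly_mapping_eqI) (simp add: mono_dvd_def lookup_add lookup_minus)
  then show "\<exists>w. v = u + w" by blast
qed auto

lemma upclosed_iff_mono_dvd: "upclosed U \<longleftrightarrow> (\<forall>u\<in>U. \<forall>v. mono_dvd u v \<longrightarrow> v \<in> U)"
  by (auto simp: upclosed_def mono_dvd_iff_add)

lemma upclosed_multiples [simp]: "upclosed (multiples B)"
  unfolding upclosed_iff_mono_dvd multiples_def using mono_dvd_trans by blast

lemma multiples_upclosed: "upclosed U \<Longrightarrow> multiples U = U"
  unfolding upclosed_iff_mono_dvd multiples_def using mono_dvd_refl by blast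

lemma subset_multiples: "B \<subseteq> multiples B"
  unfolding multiples_def using mono_dvd_refl by blast

section \<open>Monomial ideals of the polynomial ring\<close>

lemma mpoly_ring_simps [simp]:
  "carrier (mpoly_ring :: ('n, 'k) mpoly ring) = UNIV"
  "f \<otimes>\<^bsub>mpoly_ring\<^esub> g = f * g"
  "f \<oplus>\<^bsub>mpoly_ring\<^esub> g = f + g"
  "\<zero>\<^bsub>mpoly_ring\<^esub> = (0 :: ('n, 'k) mpoly)"
  "\<one>\<^bsub>mpoly_ring\<^esub> = (1 :: ('n, 'k) mpoly)"
  for f g :: "('n, 'k::field) mpoly"
  by (simp_all add: ring_of_type_algebra_def)

lemma cring_mpoly: "cring (mpoly_ring :: ('n, 'k::field) mpoly ring)"
  by (rule cring_from_type_algebra)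

lemma ring_mpoly: "ring (mpoly_ring :: ('n, 'k::field) mpoly ring)"
  by (rule ring_from_type_algebra)

lemma ideal_mpoly_iff:
  fixes I :: "('n, 'k::field) mpoly set"
  shows "ideal I mpoly_ring \<longleftrightarrow>
    0 \<in> I \<and> (\<forall>f\<in>I. \<forall>g\<in>I. f + g \<in> I) \<and> (\<forall>f\<in>I. \<forall>g. g * f \<in> I)" (is "_ \<longleftrightarrow> ?R")
proof
  assume I: "ideal I mpoly_ring"
  interpret ideal I "mpoly_ring :: ('n, 'k) mpoly ring" by fact
  show ?R
    using additive_subgroup.zero_closed[OF is_additive_subgroup]
      additive_subgroup.a_closed[OF is_additive_subgroup] I_l_closed by simp
next
  assume R: ?R
  interpret M: ring "mpoly_ring :: ('n, 'k) mpoly ring" by (rule ring_mpoly)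
  show "ideal I mpoly_ring"
  proof (rule idealI)
    show "ring (mpoly_ring :: ('n, 'k) mpoly ring)" by (rule ring_mpoly)
    show "subgroup I (add_monoid (mpoly_ring :: ('n, 'k) mpoly ring))"
    proof (rule M.add.subgroupI)
      fix f assume f: "f \<in> I"
      have "f \<oplus>\<^bsub>mpoly_ring\<^esub> (- 1 * f) = \<zero>\<^bsub>mpoly_ring\<^esub>" by simp
      then have "\<ominus>\<^bsub>mpoly_ring\<^esub> f = - 1 * f"
        by (metis M.minus_equality M.a_comm UNIV_I mpoly_ring_simps(1))
      then show "\<ominus>\<^bsub>mpoly_ring\<^esub> f \<in> I" using R f by metis
    qed (use R in auto)
  qed (use R in \<open>auto simp: mult.commute\<close>)
qed

lemma poly_eq_sum_of_terms:
  "f = (\<Sum>u\<in>Poly_Mapping.keys f. Poly_Mapping.single u (Poly_Mapping.lookup f u))"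
  by (rule poly_mapping_eqI)
    (simp add: lookup_sum lookup_single when_def in_keys_iff)

text \<open>A polynomial is a combination of the monomials occurring in it, with scalar coefficients.\<close>

lemma mem_ideal_if_terms:
  fixes I :: "('n, 'k::field) mpoly set"
  assumes I: "ideal I mpoly_ring" and terms: "\<And>u. u \<in> Poly_Mapping.keys f \<Longrightarrow> xmon u \<in> I"
  shows "f \<in> I"
proof -
  have "Poly_Mapping.single u c \<in> I" if "u \<in> Poly_Mapping.keys f" for u and c :: 'k
  proof -
    have "Poly_Mapping.single 0 c * xmon u \<in> I"
      using I terms[OF that] unfolding ideal_mpoly_iff by blast
    then show ?thesis by (simp add: xmon_def mult_single)
  qed
  then have "(\<Sum>u\<in>Y. Poly_Mapping.single u (Poly_Mapping.lookup f u)) \<in> I"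
    if "Y \<subseteq> Poly_Mapping.keys f" for Y
    using that I by (induction Y rule: infinite_finite_induct) (auto simp: ideal_mpoly_iff)
  from this[of "Poly_Mapping.keys f"] show ?thesis
    by (subst poly_eq_sum_of_terms) simp
qed

lemma keys_xmon [simp]: "Poly_Mapping.keys (xmon u :: ('n, 'k::field) mpoly) = {u}"
  by (simp add: xmon_def)

lemma xmon_mem_polys_on [simp]: "(xmon u :: ('n, 'k::field) mpoly) \<in> polys_on U \<longleftrightarrow> u \<in> U"
  by (simp add: polys_on_def)

lemma polys_on_eq_iff:
  "(polys_on U :: ('n, 'k::field) mpoly set) = polys_on V \<longleftrightarrow> U = V"
  using xmon_mem_polys_on by blast

lemma polys_on_Int: "polys_on (U \<inter> V) = polys_on U \<inter> polys_on V"
  by (auto simp: polys_on_def)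

lemma ideal_polys_on:
  assumes "upclosed U"
  shows "ideal (polys_on U :: ('n, 'k::field) mpoly set) mpoly_ring"
  unfolding ideal_mpoly_iff
proof (intro conjI ballI allI)
  fix f g :: "('n, 'k) mpoly" assume f: "f \<in> polys_on U"
  have "Poly_Mapping.keys (g * f) \<subseteq> U"
  proof
    fix w assume "w \<in> Poly_Mapping.keys (g * f)"
    then obtain a b where "w = a + b" "b \<in> Poly_Mapping.keys f" using keys_mult by blast
    then have "w = b + a" "b \<in> U" using f by (auto simp: polys_on_def add.commute)
    then show "w \<in> U" using assms by (simp add: upclosed_def)
  qed
  then show "g * f \<in> polys_on U" by (simp add: polys_on_def)
  show "f + g \<in> polys_on U" if "g \<in> polys_on U"
    using f that keys_add[of f g] by (auto simp: polys_on_def)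
qed (auto simp: polys_on_def)

lemma monomial_span_eq: "monomial_span S = (polys_on (multiples S) :: ('n, 'k::field) mpoly set)"
proof
  interpret M: ring "mpoly_ring :: ('n, 'k) mpoly ring" by (rule ring_mpoly)
  have "xmon ` S \<subseteq> (polys_on (multiples S) :: ('n, 'k) mpoly set)"
    using subset_multiples by fastforce
  then show "monomial_span S \<subseteq> (polys_on (multiples S) :: ('n, 'k) mpoly set)"
    unfolding monomial_span_def by (intro M.genideal_minimal ideal_polys_on) auto
  have gen: "ideal (monomial_span S :: ('n, 'k) mpoly set) mpoly_ring"
    unfolding monomial_span_def by (intro M.genideal_ideal) simp
  show "(polys_on (multiples S) :: ('n, 'k) mpoly set) \<subseteq> monomial_span S"
  proof
    fix f :: "('n, 'k) mpoly" assume f: "f \<in> polys_on (multiples S)"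
    show "f \<in> monomial_span S"
    proof (rule mem_ideal_if_terms[OF gen])
      fix u assume "u \<in> Poly_Mapping.keys f"
      then obtain s w where s: "s \<in> S" and u: "u = s + w"
        using f by (auto simp: polys_on_def multiples_def mono_dvd_iff_add)
      have "xmon s \<in> (monomial_span S :: ('n, 'k) mpoly set)"
        unfolding monomial_span_def using M.genideal_self[of "xmon ` S"] s by auto
      then have "xmon w * xmon s \<in> (monomial_span S :: ('n, 'k) mpoly set)"
        using gen unfolding ideal_mpoly_iff by blast
      then show "xmon u \<in> (monomial_span S :: ('n, 'k) mpoly set)"
        by (simp add: xmon_def mult_single u add.commute)
    qed
  qed
qed

definition antichain :: "('n \<Rightarrow>\<^sub>0 nat) set \<Rightarrow> bool" where
  "antichain S \<longleftrightarrow> (\<forall>u\<in>S. \<forall>v\<in>S. mono_dvd u v \<longrightarrow> u = v)"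

text \<open>An element of an antichain \<open>S\<close> that lies above some \<open>t \<in> T\<close>, while
\<open>t\<close> lies above an element of \<open>S\<close>, must be equal to both. This is what makes the minimal
generators unique.\<close>

lemma antichain_subset_multiples:
  assumes "antichain S" and "multiples T = multiples S"
  shows "S \<subseteq> T"
proof
  fix s assume s: "s \<in> S"
  then have "s \<in> multiples T" using assms(2) subset_multiples by blast
  then obtain t where t: "t \<in> T" "mono_dvd t s" by (auto simp: multiples_def)
  then have "t \<in> multiples S" using assms(2) subset_multiples by blast
  then obtain s' where "s' \<in> S" "mono_dvd s' t" by (auto simp: multiples_def)
  then have "s' = s" using assms(1) s t mono_dvd_trans unfolding antichain_def by blast
  then have "t = s" using t \<open>mono_dvd s' t\<close> mono_dvd_antisym by blast
  then show "s \<in> T" using t by simp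
qed

lemma mono_dvd_degree_le: "mono_dvd u v \<Longrightarrow> mono_degree u \<le> mono_degree v"
  unfolding mono_degree_def mono_dvd_def by (intro sum_mono) auto

lemma mono_dvd_same_degree:
  assumes "mono_dvd u v" "mono_degree u = mono_degree v"
  shows "u = v"
proof (rule poly_mapping_eqI, rule ccontr)
  fix i assume "expo u i \<noteq> expo v i"
  then have "mono_degree u < mono_degree v"
    unfolding mono_degree_def using assms(1)
    by (intro sum_strict_mono_ex1) (auto simp: mono_dvd_def le_neq_implies_less intro!: exI[of _ i])
  then show False using assms(2) by simp
qed

text \<open>Divisibility is well-founded because proper divisors have smaller degree, so the
minimal elements of \<open>S\<close> generate the same ideal as \<open>S\<close>.\<close>

lemma antichain_generators:
  fixes S :: "('n::finite \<Rightarrow>\<^sub>0 nat) set"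
  obtains T where "T \<subseteq> S" "antichain T" "multiples T = multiples S"
proof
  let ?T = "{s \<in> S. \<forall>s'\<in>S. mono_dvd s' s \<longrightarrow> s' = s}"
  show "?T \<subseteq> S" by blast
  show "antichain ?T" by (auto simp: antichain_def)
  have below: "\<exists>t\<in>?T. mono_dvd t s" if "s \<in> S" for s
    using that
  proof (induction "mono_degree s" arbitrary: s rule: less_induct)
    case less
    show ?case
    proof (cases "s \<in> ?T")
      case True then show ?thesis using mono_dvd_refl by blast
    next
      case False
      then obtain s' where s': "s' \<in> S" "mono_dvd s' s" "s' \<noteq> s" using less.prems by blast
      then have "mono_degree s' < mono_degree s"
        using mono_dvd_degree_le mono_dvd_same_degree le_neq_implies_less by metis
      then show ?thesis using less.hyps s' mono_dvd_trans by blast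
    qed
  qed
  show "multiples ?T = multiples S"
    unfolding multiples_def using below mono_dvd_trans by blast
qed

lemma min_gens_polys_on:
  fixes S :: "('n::finite \<Rightarrow>\<^sub>0 nat) set"
  assumes S: "antichain S"
  shows "min_gens (polys_on (multiples S) :: ('n, 'k::field) mpoly set) = S"
  unfolding min_gens_def
proof (rule the_equality)
  show "monomial_span S = (polys_on (multiples S) :: ('n, 'k) mpoly set) \<and>
    (\<forall>T. T \<subset> S \<longrightarrow> monomial_span T \<noteq> (polys_on (multiples S) :: ('n, 'k) mpoly set))"
    using antichain_subset_multiples[OF S] by (auto simp: monomial_span_eq polys_on_eq_iff)
next
  fix T assume T: "monomial_span T = (polys_on (multiples S) :: ('n, 'k) mpoly set) \<and>
    (\<forall>T'. T' \<subset> T \<longrightarrow> monomial_span T' \<noteq> (polys_on (multiples S) :: ('n, 'k) mpoly set))"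
  then have "multiples T = multiples S" by (simp add: monomial_span_eq polys_on_eq_iff)
  then have "S \<subseteq> T" using antichain_subset_multiples[OF S] by blast
  then show "T = S" using T by (auto simp: monomial_span_eq)
qed

lemma monomial_ideal_min_gens:
  fixes I :: "('n::finite, 'k::field) mpoly set"
  assumes "monomial_ideal I"
  shows "I = polys_on (multiples (min_gens I))" "antichain (min_gens I)"
proof -
  obtain S where "I = monomial_span S" using assms by (auto simp: monomial_ideal_def)
  moreover obtain T where "antichain T" "multiples T = multiples S"
    using antichain_generators by blast
  ultimately have "I = polys_on (multiples T)" "antichain T" by (simp_all add: monomial_span_eq)
  then show "I = polys_on (multiples (min_gens I))" "antichain (min_gens I)"
    by (simp_all add: min_gens_polys_on)
qed

lemma ideal_prod_polys_on:
  assumes "upclosed U" "upclosed V"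
  shows "polys_on U \<cdot>\<^bsub>mpoly_ring\<^esub> polys_on V =
    (polys_on {u + v | u v. u \<in> U \<and> v \<in> V} :: ('n, 'k::field) mpoly set)" (is "?L = polys_on ?W")
proof
  interpret M: ring "mpoly_ring :: ('n, 'k) mpoly ring" by (rule ring_mpoly)
  have L: "ideal ?L mpoly_ring"
    using assms by (intro M.ideal_prod_is_ideal ideal_polys_on)
  show "?L \<subseteq> polys_on ?W"
  proof
    fix f assume "f \<in> ?L"
    then show "f \<in> polys_on ?W"
    proof induction
      case (prod i j)
      then show ?case using keys_mult[of i j] by (fastforce simp: polys_on_def)
    next
      case (sum f g)
      then show ?case using keys_add[of f g] by (auto simp: polys_on_def)
    qed
  qed
  show "polys_on ?W \<subseteq> ?L"
  proof
    fix f :: "('n, 'k) mpoly" assume f: "f \<in> polys_on ?W"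
    show "f \<in> ?L"
    proof (rule mem_ideal_if_terms[OF L])
      fix w assume "w \<in> Poly_Mapping.keys f"
      then obtain u v where "u \<in> U" "v \<in> V" "w = u + v" using f by (auto simp: polys_on_def)
      then show "xmon w \<in> ?L"
        using ideal_prod.prod[of "xmon u" "polys_on U" "xmon v" "polys_on V"
            "mpoly_ring :: ('n, 'k) mpoly ring"]
        by (simp add: xmon_def mult_single polys_on_def)
    qed
  qed
qed

section \<open>Partial degrees and covers\<close>

lemma partial_degree_add: "partial_degree A (u + v) = partial_degree A u + partial_degree A v"
  by (simp add: partial_degree_def lookup_add sum.distrib)

lemma partial_degree_single: "partial_degree A (Poly_Mapping.single i k) = (if i \<in> A then k else 0)"
  by (simp add: partial_degree_def lookup_single when_def)

lemma partial_degree_mono: "mono_dvd u v \<Longrightarrow> partial_degree A u \<le> partial_degree A v"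
  unfolding partial_degree_def mono_dvd_def by (intro sum_mono) auto

lemma partial_degree_subset: "A \<subseteq> A' \<Longrightarrow> partial_degree A u \<le> partial_degree A' u"
  unfolding partial_degree_def by (intro sum_mono2) auto

lemma partial_degree_Diff:
  "A \<subseteq> A' \<Longrightarrow> partial_degree A' u = partial_degree A u + partial_degree (A' - A) u"
  unfolding partial_degree_def by (metis add.commute finite sum.subset_diff)

lemma expo_le_partial_degree: "i \<in> A \<Longrightarrow> expo u i \<le> partial_degree A u"
  unfolding partial_degree_def by (intro member_le_sum) auto

lemma partial_degree_eq_0_iff: "partial_degree A u = 0 \<longleftrightarrow> (\<forall>i\<in>A. expo u i = 0)"
  by (simp add: partial_degree_def)

lemma mono_degree_eq: "mono_degree u = partial_degree UNIV u"
  by (simp add: mono_degree_def partial_degree_def)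

lemma partial_degree_cong:
  "(\<And>i. i \<in> A \<Longrightarrow> expo u i = expo v i) \<Longrightarrow> partial_degree A u = partial_degree A v"
  by (simp add: partial_degree_def)

lemma expo_exchange_var:
  "expo (u - var i + var j) k = expo u k - of_bool (k = i) + of_bool (k = j)"
  by (auto simp: lookup_add lookup_minus lookup_single when_def)

lemmas expo_exchange = expo_exchange_var expo_exchange_var[unfolded One_nat_def]

text \<open>The indicators stand on both sides, so that no truncated subtraction is needed.\<close>

lemma partial_degree_exchange:
  assumes "0 < expo u i"
  shows "partial_degree A (u - var i + var j) + of_bool (i \<in> A) = partial_degree A u + of_bool (j \<in> A)"
proof -
  have "u - var i + var i = u"
    using assms by (intro poly_mapping_eqI) (auto simp: expo_exchange)
  then have "partial_degree A (u - var i) + of_bool (i \<in> A) = partial_degree A u"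
    using partial_degree_add[of A "u - var i" "var i"] by (simp add: partial_degree_single)
  then show ?thesis by (simp add: partial_degree_add partial_degree_single)
qed

text \<open>For the exponents \<open>B\<close> of the generators of a monomial ideal, \<open>C\<close> is a cover iff the ideal
generated by the variables in \<open>C\<close> contains the monomial ideal. Minimal covers correspond to
minimal primes.\<close>

definition cover :: "('n::finite \<Rightarrow>\<^sub>0 nat) set \<Rightarrow> 'n set \<Rightarrow> bool" where
  "cover B C \<longleftrightarrow> (\<forall>v\<in>B. 0 < partial_degree C v)"

definition min_cover :: "('n::finite \<Rightarrow>\<^sub>0 nat) set \<Rightarrow> 'n set \<Rightarrow> bool" where
  "min_cover B C \<longleftrightarrow> cover B C \<and> (\<forall>C'. C' \<subset> C \<longrightarrow> \<not> cover B C')"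

text \<open>For nonempty \<open>B\<close>, the largest exponent for which the power of the ideal generated by \<open>C\<close> contains the monomial
ideal generated by \<open>B\<close>.\<close>

definition order_along :: "('n::finite \<Rightarrow>\<^sub>0 nat) set \<Rightarrow> 'n set \<Rightarrow> nat" where
  "order_along B C = Inf (partial_degree C ` B)"

lemma order_along_le: "v \<in> B \<Longrightarrow> order_along B C \<le> partial_degree C v"
  unfolding order_along_def by (intro cInf_lower) auto

lemma order_along_attained:
  assumes "B \<noteq> {}"
  obtains v where "v \<in> B" "partial_degree C v = order_along B C"
proof -
  have "Inf (partial_degree C ` B) \<in> partial_degree C ` B"
    using assms by (intro Inf_nat_def1) simp
  then show thesis using that unfolding order_along_def by force
qed

lemma cover_contains_min_cover:
  assumes "cover B A"
  obtains C where "C \<subseteq> A" "min_cover B C"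
proof -
  have "\<exists>C\<in>{C. C \<subseteq> A \<and> cover B C}. C \<subseteq> A \<and> (\<forall>C'\<in>{C. C \<subseteq> A \<and> cover B C}. C' \<subseteq> C \<longrightarrow> C = C')"
    using assms by (intro finite_has_minimal2) auto
  then obtain C where C: "C \<subseteq> A" "cover B C"
    and minimal: "\<And>C'. C' \<subseteq> A \<Longrightarrow> cover B C' \<Longrightarrow> C' \<subseteq> C \<Longrightarrow> C = C'" by auto
  have "\<not> cover B C'" if "C' \<subset> C" for C' using minimal[of C'] that C by auto
  then show thesis using that C by (simp add: min_cover_def)
qed

lemma min_cover_antichain: "min_cover B C \<Longrightarrow> min_cover B C' \<Longrightarrow> C \<subseteq> C' \<Longrightarrow> C = C'"
  unfolding min_cover_def by blast

lemma order_along_pos: "B \<noteq> {} \<Longrightarrow> cover B C \<Longrightarrow> 0 < order_along B C"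
  by (metis cover_def order_along_attained)

section \<open>Bases of a discrete polymatroid\<close>

text \<open>The exponents of the generators of a polymatroidal ideal are the bases of a discrete polymatroid
of rank \<open>d\<close>.\<close>

locale polymatroid =
  fixes B :: "('n::finite \<Rightarrow>\<^sub>0 nat) set" and d :: nat
  assumes nonempty: "B \<noteq> {}"
    and degree: "u \<in> B \<Longrightarrow> mono_degree u = d"
    and exchange: "u \<in> B \<Longrightarrow> v \<in> B \<Longrightarrow> expo v i < expo u i \<Longrightarrow>
      \<exists>j. expo u j < expo v j \<and> u - var i + var j \<in> B"
begin

lemma partial_degree_le: "v \<in> B \<Longrightarrow> partial_degree A v \<le> d"
  using degree partial_degree_subset[of A UNIV v] by (simp add: mono_degree_eq)

lemma expo_le: "v \<in> B \<Longrightarrow> expo v i \<le> d"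
  using expo_le_partial_degree[of i UNIV v] partial_degree_le[of v UNIV] by simp

text \<open>As \<open>C - {t}\<close> is not a cover, some base \<open>w\<close> involves no variable of \<open>C\<close> except \<open>t\<close>. In
the exchange of \<open>v\<close> against \<open>w\<close> at \<open>q\<close>, the incoming variable has to lie in \<open>C\<close>, since
the degree in \<open>C\<close> cannot drop below its minimum; hence it is \<open>t\<close>.\<close>

lemma swap_in_min_cover:
  assumes C: "min_cover B C" and v: "v \<in> B" "partial_degree C v = order_along B C"
    and q: "q \<in> C" "0 < expo v q" and t: "t \<in> C"
  shows "v - var q + var t \<in> B"
proof (cases "q = t")
  case True
  then have "v - var q + var t = v"
    using q by (intro poly_mapping_eqI) (auto simp: expo_exchange)
  then show ?thesis using v by simp
next
  case False
  have "C - {t} \<subset> C" using t by blast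
  then obtain w where w: "w \<in> B" "partial_degree (C - {t}) w = 0"
    using C unfolding min_cover_def cover_def by blast
  then have "expo w q = 0" using q False by (auto simp: partial_degree_eq_0_iff)
  then obtain j where j: "expo v j < expo w j" "v - var q + var j \<in> B"
    using exchange[OF v(1) w(1), of q] q by auto
  have "j \<in> C"
    using order_along_le[OF j(2), of C] partial_degree_exchange[OF q(2), of C j] q(1) v(2)
    by (cases "j \<in> C") auto
  then have "j \<noteq> t \<Longrightarrow> expo w j = 0" using w(2) unfolding partial_degree_eq_0_iff by blast
  then have "j = t" using j(1) by linarith
  then show ?thesis using j by simp
qed

text \<open>Iterated swaps: at its minimal primes, a polymatroidal ideal is locally a power of the prime.\<close>

lemma redistribute_in_min_cover:
  assumes C: "min_cover B C" and v: "v \<in> B" "partial_degree C v = order_along B C"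
    and m: "order_along B C \<le> partial_degree C m"
  obtains v' where "v' \<in> B" "\<And>i. i \<in> C \<Longrightarrow> expo v' i \<le> expo m i"
    "\<And>i. i \<notin> C \<Longrightarrow> expo v' i = expo v i"
proof -
  have "\<exists>v'\<in>B. (\<forall>i\<in>C. expo v' i \<le> expo m i) \<and> (\<forall>i. i \<notin> C \<longrightarrow> expo v' i = expo v i)"
    using v
  proof (induction "\<Sum>i\<in>C. expo v i - expo m i" arbitrary: v rule: less_induct)
    case less
    show ?case
    proof (cases "\<forall>i\<in>C. expo v i \<le> expo m i")
      case True then show ?thesis using less.prems by blast
    next
      case False
      then obtain q where q: "q \<in> C" "expo m q < expo v q" by auto
      have "\<not> (\<forall>i\<in>C. expo m i \<le> expo v i)"
      proof
        assume "\<forall>i\<in>C. expo m i \<le> expo v i"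
        then have "partial_degree C m < partial_degree C v"
          unfolding partial_degree_def using q by (intro sum_strict_mono_ex1) auto
        then show False using less.prems m by simp
      qed
      then obtain t where t: "t \<in> C" "expo v t < expo m t" by auto
      let ?v = "v - var q + var t"
      have qt: "q \<noteq> t" using q t by auto
      have B: "?v \<in> B" using swap_in_min_cover[OF C] less.prems q t by auto
      have "partial_degree C ?v = order_along B C"
        using partial_degree_exchange[of v q C t] q t less.prems by simp
      moreover have "(\<Sum>i\<in>C. expo ?v i - expo m i) < (\<Sum>i\<in>C. expo v i - expo m i)"
        using q t qt by (intro sum_strict_mono_ex1) (auto simp: expo_exchange intro!: bexI[of _ q])
      ultimately obtain v' where "v' \<in> B" "\<forall>i\<in>C. expo v' i \<le> expo m i"
        "\<forall>i. i \<notin> C \<longrightarrow> expo v' i = expo ?v i"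
        using less.hyps B by blast
      then show ?thesis using q t by (auto simp: expo_exchange)
    qed
  qed
  then show thesis using that by blast
qed

text \<open>Starting from a base of minimal degree in \<open>D\<close>, exchange against a base of minimal
degree in \<open>C\<close>. Each step moves closer to the latter on \<open>C\<close>, and an outgoing variable in \<open>D\<close> must
be replaced by one in \<open>D\<close>, because the degree in \<open>D\<close> is already minimal.\<close>

lemma nested_order_along_attained:
  assumes "C \<subseteq> D"
  obtains v where "v \<in> B" "partial_degree D v = order_along B D" "partial_degree C v = order_along B C"
proof -
  obtain u where u: "u \<in> B" "partial_degree C u = order_along B C"
    using order_along_attained[OF nonempty] .
  have "\<exists>v\<in>B. partial_degree D v = order_along B D \<and> partial_degree C v = order_along B C"
    if "v \<in> B" "partial_degree D v = order_along B D" for v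
    using that
  proof (induction "\<Sum>i\<in>C. expo v i - expo u i" arbitrary: v rule: less_induct)
    case less
    show ?case
    proof (cases "\<forall>i\<in>C. expo v i \<le> expo u i")
      case True
      then have "partial_degree C v \<le> partial_degree C u"
        unfolding partial_degree_def by (intro sum_mono) auto
      then show ?thesis using less.prems u order_along_le[of v B C] by (metis antisym)
    next
      case False
      then obtain i where i: "i \<in> C" "expo u i < expo v i" by auto
      then obtain j where j: "expo v j < expo u j" "v - var i + var j \<in> B"
        using exchange less.prems u by blast
      let ?v = "v - var i + var j"
      have "partial_degree D ?v + 1 = partial_degree D v + of_bool (j \<in> D)"
        using partial_degree_exchange[of v i D j] i assms by auto
      then have "partial_degree D ?v = order_along B D"
        using order_along_le[OF j(2), of D] less.prems by (cases "j \<in> D") auto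
      moreover have "(\<Sum>i\<in>C. expo ?v i - expo u i) < (\<Sum>i\<in>C. expo v i - expo u i)"
        using i j by (intro sum_strict_mono_ex1) (auto simp: expo_exchange intro!: bexI[of _ i])
      ultimately show ?thesis using less.hyps j by blast
    qed
  qed
  moreover obtain v where "v \<in> B" "partial_degree D v = order_along B D"
    using order_along_attained[OF nonempty] .
  ultimately show thesis using that by blast
qed

end

section \<open>Polymatroids cut out by their minimal covers\<close>

text \<open>The hypothesis says that the ideal is the intersection of the powers of its minimal primes that
contain it. In contrast to unmixedness this is a purely combinatorial condition.\<close>

locale saturated_polymatroid = polymatroid B d for B :: "('n::finite \<Rightarrow>\<^sub>0 nat) set" and d +
  assumes saturated: "(\<And>C. min_cover B C \<Longrightarrow> order_along B C \<le> partial_degree C u) \<Longrightarrow> u \<in> multiples B"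
begin

lemma multiples_eq:
  "multiples B = {u. \<forall>C. min_cover B C \<longrightarrow> order_along B C \<le> partial_degree C u}"
proof
  show "multiples B \<subseteq> {u. \<forall>C. min_cover B C \<longrightarrow> order_along B C \<le> partial_degree C u}"
    unfolding multiples_def using order_along_le partial_degree_mono le_trans by blast
  show "{u. \<forall>C. min_cover B C \<longrightarrow> order_along B C \<le> partial_degree C u} \<subseteq> multiples B"
    using saturated by blast
qed

text \<open>Inverting the variables outside \<open>D\<close> amounts to giving them large exponents; only the minimal
covers inside \<open>D\<close> remain as conditions.\<close>

lemma saturated_localized:
  assumes "\<And>C. min_cover B C \<Longrightarrow> C \<subseteq> D \<Longrightarrow> order_along B C \<le> partial_degree C m"
  obtains v where "v \<in> B" "\<And>i. i \<in> D \<Longrightarrow> expo v i \<le> expo m i"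
proof -
  let ?u = "mon_of (\<lambda>i. if i \<in> D then expo m i else d)"
  have "?u \<in> multiples B"
  proof (rule saturated)
    fix C assume C: "min_cover B C"
    show "order_along B C \<le> partial_degree C ?u"
    proof (cases "C \<subseteq> D")
      case True
      then have "partial_degree C ?u = partial_degree C m" by (intro partial_degree_cong) auto
      then show ?thesis using assms C True by simp
    next
      case False
      then obtain i where "i \<in> C" "i \<notin> D" by blast
      then have "d \<le> partial_degree C ?u" using expo_le_partial_degree[of i C ?u] by simp
      moreover obtain v where "v \<in> B" using nonempty by blast
      ultimately show ?thesis
        using order_along_le[of v B C] partial_degree_le[of v C] by simp
    qed
  qed
  then obtain v where v: "v \<in> B" "mono_dvd v ?u" by (auto simp: multiples_def)
  show thesis
  proof (rule that[OF v(1)])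
    fix i assume "i \<in> D"
    moreover have "expo v i \<le> expo ?u i" using v(2) unfolding mono_dvd_def by blast
    ultimately show "expo v i \<le> expo m i" by simp
  qed
qed

text \<open>The bound 2 is needed to fit two different variables \<open>s\<close> and \<open>t\<close> into a monomial of degree
\<open>order_along B C\<close>. For light covers the conclusion fails: the three minimal covers of the
generators \<open>xy\<close>, \<open>xz\<close>, \<open>yz\<close> meet pairwise.\<close>

lemma heavy_min_cover_disjoint:
  assumes C: "min_cover B C" and heavy: "2 \<le> order_along B C"
    and C0: "min_cover B C0" "C0 \<noteq> C"
  shows "C \<inter> C0 = {}"
proof (rule ccontr)
  assume "C \<inter> C0 \<noteq> {}"
  then have "C0 \<in> {C'. min_cover B C' \<and> C' \<noteq> C \<and> C \<inter> C' \<noteq> {}}" using C0 by blast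
  \<comment> \<open>With \<open>C \<union> C'\<close> as small as possible, every minimal cover inside it other than \<open>C\<close>
    meets \<open>C\<close> and contains all the elements of \<open>C'\<close> outside \<open>C\<close>.\<close>
  then obtain C' where C': "min_cover B C'" "C' \<noteq> C" "C \<inter> C' \<noteq> {}"
    and least: "\<And>C''. min_cover B C'' \<Longrightarrow> C'' \<noteq> C \<Longrightarrow> C \<inter> C'' \<noteq> {} \<Longrightarrow> card (C \<union> C') \<le> card (C \<union> C'')"
    using ex_has_least_nat[of "\<lambda>C'. min_cover B C' \<and> C' \<noteq> C \<and> C \<inter> C' \<noteq> {}" C0 "\<lambda>C'. card (C \<union> C')"]
    by blast
  define D where "D = C \<union> C'"
  have within: "D - C \<subseteq> C'' \<and> C \<inter> C'' \<noteq> {}"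
    if C'': "min_cover B C''" "C'' \<subseteq> D" "C'' \<noteq> C" for C''
  proof -
    have meets: "C \<inter> C'' \<noteq> {}"
    proof
      assume "C \<inter> C'' = {}"
      then have "C'' \<subseteq> C'" using C'' D_def by blast
      then have "C'' = C'" using C'' C' min_cover_antichain by blast
      then show False using C' \<open>C \<inter> C'' = {}\<close> by blast
    qed
    have "C \<union> C'' = D"
      using least[of C''] C'' meets D_def by (intro card_seteq) auto
    then show ?thesis using meets by blast
  qed
  define c where "c = order_along B D - order_along B C"
  obtain v0 where v0: "v0 \<in> B" "partial_degree D v0 = order_along B D"
    "partial_degree C v0 = order_along B C"
    using nested_order_along_attained[of C D] D_def by blast
  then have c: "partial_degree (D - C) v0 = c"
    using partial_degree_Diff[of C D v0] D_def c_def by simp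
  \<comment> \<open>These bases have minimal degree in \<open>D\<close>; their part in \<open>C\<close> is arbitrary, their part in
    \<open>D - C\<close> is that of \<open>v0\<close>.\<close>
  have base: "\<exists>v\<in>B. (\<forall>i\<in>C. expo v i = expo m i) \<and> (\<forall>i\<in>D - C. expo v i = expo v0 i)"
    if m: "partial_degree C m = order_along B C" for m
  proof -
    obtain v where v: "v \<in> B" "\<And>i. i \<in> C \<Longrightarrow> expo v i \<le> expo m i"
      "\<And>i. i \<notin> C \<Longrightarrow> expo v i = expo v0 i"
      using redistribute_in_min_cover[OF C v0(1,3)] m by (metis order_refl)
    have "expo v i = expo m i" if "i \<in> C" for i
    proof (rule ccontr)
      assume "expo v i \<noteq> expo m i"
      then have "partial_degree C v < partial_degree C m"
        unfolding partial_degree_def using v(2) that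
        by (intro sum_strict_mono_ex1) (auto intro!: bexI[of _ i] le_neq_implies_less)
      then show False using order_along_le[OF v(1), of C] m by simp
    qed
    then show ?thesis using v by blast
  qed
  have c_ge: "order_along B C'' \<le> c" if C'': "min_cover B C''" "C'' \<subseteq> D" "C'' \<noteq> C" for C''
  proof -
    obtain s where s: "s \<in> C" "s \<notin> C''" using min_cover_antichain[OF C C''(1)] C''(3) by blast
    obtain v where v: "v \<in> B" "\<And>i. i \<in> C \<Longrightarrow> expo v i = expo (Poly_Mapping.single s (order_along B C)) i"
      "\<And>i. i \<in> D - C \<Longrightarrow> expo v i = expo v0 i"
      using base[of "Poly_Mapping.single s (order_along B C)"] s
      unfolding partial_degree_single by (metis (no_types, lifting))
    have "partial_degree C'' v = partial_degree (D - C) v"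
      unfolding partial_degree_def
      using within[OF C''] C'' s v(2)
      by (intro sum.mono_neutral_right) (auto simp: lookup_single when_def split: if_splits)
    also have "\<dots> = partial_degree (D - C) v0" using v(3) by (rule partial_degree_cong)
    finally show ?thesis using c order_along_le[OF v(1), of C''] by simp
  qed
  have "c > 0"
    using c_ge[of C'] C' D_def order_along_pos[OF nonempty, of C'] by (auto simp: min_cover_def)
  then obtain q where q: "q \<in> D - C" "0 < expo v0 q"
    using c by (metis gr0I less_numeral_extra(3) partial_degree_eq_0_iff)
  \<comment> \<open>Dividing such a base by \<open>q\<close> leaves the ideal, whatever the exponents outside \<open>D\<close>, so a
    constraint inside \<open>D\<close> is violated; it belongs to a cover containing \<open>q\<close> and no variable of \<open>m\<close>.\<close>
  have avoid: "\<exists>C''. min_cover B C'' \<and> C'' \<subseteq> D \<and> C'' \<noteq> C \<and> partial_degree C'' m = 0 \<and> order_along B C'' = c"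
    if m: "partial_degree C m = order_along B C" "\<And>i. i \<notin> C \<Longrightarrow> expo m i = 0" for m
  proof (rule ccontr)
    assume no: "\<not> ?thesis"
    \<comment> \<open>The base with part \<open>m\<close> in \<open>C\<close>, divided by \<open>q\<close>.\<close>
    let ?n = "mon_of (\<lambda>i. if i \<in> C then expo m i else expo v0 i - of_bool (i = q))"
    have n_out: "partial_degree (D - C) ?n + 1 = c"
    proof -
      have "partial_degree (D - C) v0 = partial_degree (D - C) ?n + partial_degree (D - C) (var q)"
        unfolding partial_degree_def sum.distrib[symmetric]
        using q by (intro sum.cong) (auto simp: lookup_single when_def)
      then show ?thesis using c q by (simp add: partial_degree_single)
    qed
    have n_in: "partial_degree A ?n = partial_degree A m" if "A \<subseteq> C" for A
      using that by (intro partial_degree_cong) auto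
    obtain w where w: "w \<in> B" "\<And>i. i \<in> D \<Longrightarrow> expo w i \<le> expo ?n i"
    proof (rule saturated_localized[of D ?n])
      fix C'' assume C'': "min_cover B C''" "C'' \<subseteq> D"
      show "order_along B C'' \<le> partial_degree C'' ?n"
      proof (cases "C'' = C")
        case True then show ?thesis using n_in m by simp
      next
        case False
        have "C'' - (C'' \<inter> C) = D - C" using within[OF C'' False] C'' by blast
        then have "partial_degree C'' ?n = partial_degree (C'' \<inter> C) ?n + partial_degree (D - C) ?n"
          using partial_degree_Diff[of "C'' \<inter> C" C'' ?n] by simp
        moreover have "partial_degree C'' m = partial_degree (C'' \<inter> C) m"
          unfolding partial_degree_def using m(2) by (intro sum.mono_neutral_right) auto
        moreover have "partial_degree C'' m \<noteq> 0 \<or> order_along B C'' \<noteq> c"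
          using no[unfolded not_ex, rule_format, of C''] C'' False by simp
        ultimately show ?thesis
          using n_in[of "C'' \<inter> C"] n_out c_ge[OF C'' False] by auto
      qed
    qed blast
    have "partial_degree D w \<le> partial_degree D ?n"
      unfolding partial_degree_def using w(2) by (intro sum_mono) auto
    also have "\<dots> + 1 = order_along B C + c"
      using partial_degree_Diff[of C D ?n] n_in[of C] n_out m(1) D_def by simp
    also have "\<dots> = order_along B D"
      using partial_degree_Diff[of C D v0] v0 c D_def by simp
    finally show False using order_along_le[OF w(1), of D] by simp
  qed
  obtain s where s: "s \<in> C" using C' by blast
  define r where "r = order_along B C"
  \<comment> \<open>A cover avoiding \<open>s\<close>, and then one avoiding \<open>s\<close> together with a variable \<open>t\<close> of the first.\<close>
  obtain C1 where C1: "min_cover B C1" "C1 \<subseteq> D" "C1 \<noteq> C" "s \<notin> C1" "order_along B C1 = c"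
  proof -
    have "partial_degree C (Poly_Mapping.single s r) = order_along B C" using s r_def by (simp add: partial_degree_single)
    moreover have "expo (Poly_Mapping.single s r) i = 0" if "i \<notin> C" for i
      using that s by (auto simp: lookup_single when_def)
    ultimately obtain C1 where "min_cover B C1" "C1 \<subseteq> D" "C1 \<noteq> C"
      "partial_degree C1 (Poly_Mapping.single s r) = 0" "order_along B C1 = c"
      using avoid by blast
    moreover from this have "s \<notin> C1"
      using heavy r_def by (auto simp: partial_degree_single split: if_splits)
    ultimately show thesis using that by blast
  qed
  obtain t where t: "t \<in> C" "t \<in> C1" using within[OF C1(1-3)] by blast
  obtain C2 where C2: "min_cover B C2" "C2 \<subseteq> D" "C2 \<noteq> C" "s \<notin> C2" "t \<notin> C2" "order_along B C2 = c"
  proof -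
    let ?m = "Poly_Mapping.single s (r - 1) + var t"
    have "partial_degree C ?m = order_along B C"
      using s t r_def heavy by (simp add: partial_degree_add partial_degree_single)
    moreover have "expo ?m i = 0" if "i \<notin> C" for i
      using that s t by (auto simp: lookup_single lookup_add when_def)
    ultimately obtain C2 where "min_cover B C2" "C2 \<subseteq> D" "C2 \<noteq> C"
      "partial_degree C2 ?m = 0" "order_along B C2 = c"
      using avoid by blast
    moreover from this have "s \<notin> C2" "t \<notin> C2"
      using heavy r_def by (auto simp: partial_degree_add partial_degree_single split: if_splits)
    ultimately show thesis using that by blast
  qed
  obtain v where v: "v \<in> B" "\<And>i. i \<in> C \<Longrightarrow> expo v i = expo (Poly_Mapping.single s r) i"
    "\<And>i. i \<in> D - C \<Longrightarrow> expo v i = expo v0 i"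
    using base[of "Poly_Mapping.single s r"] s
    unfolding partial_degree_single r_def by (metis (no_types, lifting))
  have v_c: "partial_degree A v = c"
    if A: "D - C \<subseteq> A" "A \<subseteq> D" "s \<notin> A" for A
  proof -
    have "partial_degree A v = partial_degree (D - C) v"
      unfolding partial_degree_def
      using A v(2) by (intro sum.mono_neutral_right) (auto simp: lookup_single when_def split: if_splits)
    also have "\<dots> = partial_degree (D - C) v0" using v(3) by (rule partial_degree_cong)
    finally show ?thesis using c by simp
  qed
  \<comment> \<open>In \<open>C1\<close> the base \<open>v\<close> has minimal degree, so \<open>q\<close> may be replaced by \<open>t\<close>. This lowers
    the degree in \<open>C2\<close>, which contains \<open>q\<close> but not \<open>t\<close>, below its minimum.\<close>
  have qC: "q \<in> C1" "q \<in> C2" "0 < expo v q" "q \<noteq> t"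
    using within[OF C1(1-3)] within[OF C2(1-3)] q v(3)[OF q(1)] t by auto
  have "v - var q + var t \<in> B"
    using swap_in_min_cover[OF C1(1) v(1)] v_c[of C1] within[OF C1(1-3)] C1 qC t by auto
  then have "c \<le> partial_degree C2 (v - var q + var t)"
    using order_along_le C2(6) by blast
  moreover have "partial_degree C2 (v - var q + var t) + 1 = c"
    using partial_degree_exchange[OF qC(3), of C2 t] qC C2 v_c[of C2] within[OF C2(1-3)] by simp
  ultimately show False by simp
qed


text \<open>By disjointness, a constraint of a heavy cover and a constraint of a light cover never involve the same
variable, so a minimal solution of all constraints is the sum of a minimal solution of the heavy
ones and one of the light ones. With the heavy part fixed, the set \<open>G\<close> of the light parts
inherits exchange from \<open>B\<close>; it is squarefree because the light covers have order 1. If there are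
no light covers, \<open>G\<close> consists of the monomial 1 only.\<close>

lemma split_off_heavy:
  assumes H_def: "H = {C. min_cover B C \<and> 2 \<le> order_along B C}"
    and L_def: "L = {C. min_cover B C \<and> \<not> 2 \<le> order_along B C}"
  obtains G e where "antichain G" "polymatroid G e"
    "multiples G = {u. \<forall>C\<in>L. 0 < partial_degree C u}"
    "\<forall>g\<in>G. \<forall>i. expo g i \<le> 1"
    "\<forall>g\<in>G. \<forall>i\<in>\<Union>H. expo g i = 0"
    "(\<Sum>C\<in>H. order_along B C) + e = d"
proof -
  define V where "V = {u. \<forall>C\<in>L. 0 < partial_degree C u}"
  have "upclosed V"
    unfolding V_def upclosed_def by (simp add: partial_degree_add)
  then obtain G where G: "G \<subseteq> V" "antichain G" "multiples G = V"
    using antichain_generators[of V] multiples_upclosed[of V] by metis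
  have pos: "0 < order_along B C" if "min_cover B C" for C
    using that order_along_pos[OF nonempty] by (simp add: min_cover_def)
  have nonempty_cover: "C \<noteq> {}" if "min_cover B C" for C
    using that nonempty by (auto simp: min_cover_def cover_def partial_degree_def)
  have L_H: "C \<inter> C' = {}" if "C \<in> L" "C' \<in> H" for C C'
    using that heavy_min_cover_disjoint[of C' C] unfolding H_def L_def by blast
  have H_H: "C \<inter> C' = {}" if "C \<in> H" "C' \<in> H" "C \<noteq> C'" for C C'
    using that heavy_min_cover_disjoint[of C' C] unfolding H_def by blast
  have "G \<noteq> {}"
  proof -
    have "mon_of (\<lambda>_. 1) \<in> V"
      using nonempty_cover by (auto simp: V_def L_def partial_degree_def card_gt_0_iff)
    then show ?thesis using G(3) by (auto simp: multiples_def)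
  qed
  have below: "g' = g" if "g' \<in> V" "mono_dvd g' g" "g \<in> G" for g g'
  proof -
    have "g' \<in> multiples G" using G(3) that(1) by simp
    then obtain g'' where "g'' \<in> G" "mono_dvd g'' g'" by (auto simp: multiples_def)
    then have "g'' = g" using that mono_dvd_trans G(2) unfolding antichain_def by blast
    then show ?thesis using \<open>mono_dvd g'' g'\<close> that(2) mono_dvd_antisym by blast
  qed
  define rep where "rep C = (SOME i. i \<in> C)" for C :: "'n set"
  have rep: "rep C' \<in> C \<longleftrightarrow> C = C'" if "C \<in> H" "C' \<in> H" for C C' :: "'n set"
  proof -
    have "rep C' \<in> C'"
      using nonempty_cover[of C'] that(2) unfolding rep_def H_def by (simp add: some_in_eq)
    then show ?thesis using H_H[OF that] by blast
  qed
  \<comment> \<open>The heavy part: for each heavy cover, the appropriate power of one of its variables.\<close>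
  define u0 where "u0 = mon_of (\<lambda>i. \<Sum>C\<in>H. if i = rep C then order_along B C else 0)"
  have u0_degree: "partial_degree A u0 = (\<Sum>C\<in>H. if rep C \<in> A then order_along B C else 0)" for A
    unfolding partial_degree_def u0_def expo_mon_of by (subst sum.swap) (simp add: sum.delta')
  have u0_H: "partial_degree C u0 = order_along B C" if "C \<in> H" for C
  proof -
    have "partial_degree C u0 = (\<Sum>C'\<in>H. if C = C' then order_along B C' else 0)"
      unfolding u0_degree using rep[OF that] by (intro sum.cong) auto
    then show ?thesis using that by simp
  qed
  have u0_out: "expo u0 i = 0" if "i \<notin> \<Union>H" for i
    unfolding u0_def expo_mon_of using that rep by (intro sum.neutral) auto
  have u0_L: "partial_degree C u0 = 0" if "C \<in> L" for C
    using L_H[OF that] u0_out by (auto simp: partial_degree_eq_0_iff)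
  have G_H: "expo g i = 0" if g: "g \<in> G" and i: "i \<in> \<Union>H" for g i
  proof -
    let ?g = "mon_of (\<lambda>i. if i \<in> \<Union>H then 0 else expo g i)"
    have "partial_degree C ?g = partial_degree C g" if "C \<in> L" for C
      using L_H[OF that] by (intro partial_degree_cong) auto
    then have "?g \<in> V" using g G(1) unfolding V_def by auto
    moreover have "mono_dvd ?g g" by (simp add: mono_dvd_def)
    ultimately have "?g = g" using below g by blast
    then have "expo ?g i = expo g i" by simp
    then show ?thesis using i by simp
  qed
  have add_u0: "u0 + g \<in> B" if g: "g \<in> G" for g
  proof -
    have "u0 + g \<in> multiples B"
    proof (rule saturated)
      fix C assume C: "min_cover B C"
      show "order_along B C \<le> partial_degree C (u0 + g)"
      proof (cases "C \<in> H")
        case True then show ?thesis using u0_H by (simp add: partial_degree_add)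
      next
        case False
        then have "C \<in> L" "order_along B C \<le> 1" using C by (auto simp: H_def L_def)
        moreover have "0 < partial_degree C g" using g G(1) \<open>C \<in> L\<close> by (auto simp: V_def)
        ultimately show ?thesis by (simp add: partial_degree_add)
      qed
    qed
    then obtain v where v: "v \<in> B" "mono_dvd v (u0 + g)" by (auto simp: multiples_def)
    have v_le: "expo v i \<le> expo u0 i + expo g i" for i
      using v(2) by (simp add: mono_dvd_def lookup_add)
    let ?g = "mon_of (\<lambda>i. if i \<in> \<Union>H then 0 else expo v i)"
    have "0 < partial_degree C ?g" if "C \<in> L" for C
    proof -
      have "partial_degree C ?g = partial_degree C v"
        using L_H[OF that] by (intro partial_degree_cong) auto
      then show ?thesis
        using v(1) that by (simp add: L_def min_cover_def cover_def)
    qed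
    then have "?g \<in> V" unfolding V_def by blast
    moreover have "mono_dvd ?g g"
      using v_le u0_out unfolding mono_dvd_def expo_mon_of by (metis add_0 zero_le)
    ultimately have g_eq: "?g = g" using below g by blast
    have "expo v i = expo (u0 + g) i" for i
    proof (cases "i \<in> \<Union>H")
      case True
      then obtain C where C: "C \<in> H" "i \<in> C" by blast
      have le: "expo v k \<le> expo u0 k" if "k \<in> C" for k
        using v_le[of k] G_H[OF g UnionI[OF C(1) that]] by simp
      have "expo v i = expo u0 i"
      proof (rule ccontr)
        assume "expo v i \<noteq> expo u0 i"
        then have "partial_degree C v < partial_degree C u0"
          unfolding partial_degree_def using le C
          by (intro sum_strict_mono_ex1) (auto intro!: bexI[of _ i] le_neq_implies_less)
        then show False using order_along_le[OF v(1), of C] u0_H C by simp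
      qed
      then show ?thesis using G_H[OF g True] by (simp add: lookup_add)
    next
      case False
      have "expo ?g i = expo g i" using g_eq by simp
      then show ?thesis using False u0_out by (simp add: lookup_add)
    qed
    then have "v = u0 + g" by (rule poly_mapping_eqI)
    then show ?thesis using v by simp
  qed
  have degree_G: "(\<Sum>C\<in>H. order_along B C) + mono_degree g = d" if "g \<in> G" for g
  proof -
    have "mono_degree u0 = (\<Sum>C\<in>H. order_along B C)" by (simp add: mono_degree_eq u0_degree)
    then show ?thesis
      using degree[OF add_u0[OF that]] by (simp add: mono_degree_eq partial_degree_add)
  qed
  define e where "e = d - (\<Sum>C\<in>H. order_along B C)"
  have e: "mono_degree g = e" if "g \<in> G" for g using degree_G[OF that] e_def by simp
  have of_degree: "x \<in> G" if "x \<in> V" "mono_degree x = e" for x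
  proof -
    have "x \<in> multiples G" using G(3) that(1) by simp
    then obtain g where g: "g \<in> G" "mono_dvd g x" by (auto simp: multiples_def)
    then have "g = x" using mono_dvd_same_degree e that by metis
    then show ?thesis using g by simp
  qed
  have exch: "\<exists>j. expo u j < expo v j \<and> u - var i + var j \<in> G"
    if uv: "u \<in> G" "v \<in> G" and i: "expo v i < expo u i" for u v i
  proof -
    have "expo (u0 + v) i < expo (u0 + u) i" using i by (simp add: lookup_add)
    then obtain j where j: "expo (u0 + u) j < expo (u0 + v) j"
      and B: "u0 + u - var i + var j \<in> B"
      using exchange[OF add_u0[OF uv(1)] add_u0[OF uv(2)]] by blast
    let ?x = "u - var i + var j"
    have eq: "u0 + u - var i + var j = u0 + ?x"
      using i by (intro poly_mapping_eqI) (auto simp: lookup_add lookup_minus lookup_single when_def)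
    have "?x \<in> V"
      unfolding V_def
    proof (intro CollectI ballI)
      fix C assume C: "C \<in> L"
      have "0 < partial_degree C (u0 + ?x)"
        using B C unfolding eq by (simp add: L_def min_cover_def cover_def)
      then show "0 < partial_degree C ?x" using u0_L[OF C] by (simp only: partial_degree_add)
    qed
    moreover have "mono_degree ?x = e"
      using partial_degree_exchange[of u i UNIV j] i e[OF uv(1)] by (simp add: mono_degree_eq)
    ultimately have "?x \<in> G" by (rule of_degree)
    then show ?thesis using j by (auto simp: lookup_add)
  qed
  have squarefree: "expo g i \<le> 1" if g: "g \<in> G" for g i
  proof (rule ccontr)
    assume "\<not> expo g i \<le> 1"
    then have i: "2 \<le> expo g i" by simp
    \<comment> \<open>One factor of the variable can be dropped, since light covers only ask for a positive degree.\<close>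
    let ?g = "g - var i"
    have "0 < partial_degree C ?g" if C: "C \<in> L" for C
    proof -
      have "0 < partial_degree C g" using g G(1) C unfolding V_def by blast
      then have "\<exists>k\<in>C. expo g k \<noteq> 0" using partial_degree_eq_0_iff[of C g] by auto
      then have "\<exists>k\<in>C. expo ?g k \<noteq> 0"
        using i by (force simp: lookup_minus lookup_single when_def)
      then show ?thesis using partial_degree_eq_0_iff[of C ?g] by auto
    qed
    then have "?g \<in> V" unfolding V_def by blast
    moreover have "mono_dvd ?g g" by (simp add: mono_dvd_def lookup_minus)
    ultimately have "?g = g" using below g by blast
    then have "expo ?g i = expo g i" by simp
    then show False using i by (simp add: lookup_minus)
  qed
  have "(\<Sum>C\<in>H. order_along B C) + e = d"
    using degree_G e_def \<open>G \<noteq> {}\<close> by fastforce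
  moreover have "polymatroid G e" using \<open>G \<noteq> {}\<close> e exch by (rule polymatroid.intro)
  moreover have "multiples G = {u. \<forall>C\<in>L. 0 < partial_degree C u}" using G(3) by (simp add: V_def)
  moreover have "\<forall>g\<in>G. \<forall>i. expo g i \<le> 1" using squarefree by blast
  moreover have "\<forall>g\<in>G. \<forall>i\<in>\<Union>H. expo g i = 0" using G_H by blast
  ultimately show thesis using that G(2) by simp
qed

end

section \<open>Prime, primary and associated ideals\<close>

definition colon :: "('n, 'k::field) mpoly set \<Rightarrow> ('n, 'k) mpoly \<Rightarrow> ('n, 'k) mpoly set" where
  "colon I f = {g. g * f \<in> I}"

lemma associated_primes_eq:
  fixes I :: "('n, 'k::field) mpoly set"
  shows "associated_primes mpoly_ring I = {P. primeideal P mpoly_ring \<and> (\<exists>f. P = colon I f)}"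
  by (simp add: associated_primes_def colon_def)

lemma primeideal_mpoly_iff:
  fixes P :: "('n, 'k::field) mpoly set"
  shows "primeideal P mpoly_ring \<longleftrightarrow>
    ideal P mpoly_ring \<and> 1 \<notin> P \<and> (\<forall>f g. f * g \<in> P \<longrightarrow> f \<in> P \<or> g \<in> P)" (is "_ \<longleftrightarrow> ?R")
proof
  assume P: "primeideal P mpoly_ring"
  interpret primeideal P "mpoly_ring :: ('n, 'k) mpoly ring" by fact
  have "1 \<notin> P" using I_notcarr one_imp_carrier by auto
  then show ?R using I_prime is_ideal by auto
next
  assume R: ?R
  then have "carrier (mpoly_ring :: ('n, 'k) mpoly ring) \<noteq> P" by auto
  then show "primeideal P mpoly_ring"
    using R by (intro primeidealI cring_mpoly) auto
qed

lemma prime_contains_var: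
  fixes P :: "('n::finite, 'k::field) mpoly set"
  assumes P: "primeideal P mpoly_ring" and u: "xmon u \<in> P"
  obtains i where "0 < expo u i" "xmon (var i) \<in> P"
proof -
  have "\<exists>i. 0 < expo u i \<and> xmon (var i) \<in> P"
    using u
  proof (induction "mono_degree u" arbitrary: u rule: less_induct)
    case less
    show ?case
    proof (cases "u = 0")
      case True
      then have "(1 :: ('n, 'k) mpoly) \<in> P" using less.prems by (simp add: xmon_def)
      then show ?thesis using P unfolding primeideal_mpoly_iff by blast
    next
      case False
      then obtain i where i: "0 < expo u i" by (metis gr0I lookup_zero poly_mapping_eqI)
      have eq: "u = (u - var i) + var i"
        using i by (intro poly_mapping_eqI) (auto simp: expo_exchange)
      then have "xmon u = (xmon (u - var i) * xmon (var i) :: ('n, 'k) mpoly)"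
        by (simp add: xmon_def mult_single)
      then have "xmon (u - var i) \<in> P \<or> xmon (var i) \<in> P"
        using less.prems P unfolding primeideal_mpoly_iff by metis
      then show ?thesis
      proof
        assume "xmon (u - var i) \<in> P"
        moreover have "mono_degree (u - var i) < mono_degree u"
        proof -
          have "mono_degree u = mono_degree ((u - var i) + var i)" using eq by simp
          then show ?thesis by (simp add: mono_degree_eq partial_degree_add partial_degree_single)
        qed
        ultimately obtain j where j: "0 < expo (u - var i) j" "xmon (var j) \<in> P"
          using less.hyps by blast
        then have "0 < expo u j" by (simp add: lookup_minus)
        then show ?thesis using j by blast
      qed (use i in blast)
    qed
  qed
  then show thesis using that by blast
qed

text \<open>Otherwise there is an element outside \<open>P\<close> in each of the ideals, and the product of these elements lies in
the intersection but not in \<open>P\<close>.\<close>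

lemma prime_contains_finite_Inter:
  fixes P :: "('n, 'k::field) mpoly set"
  assumes P: "primeideal P mpoly_ring" and K: "finite K"
    and Q: "\<And>k. k \<in> K \<Longrightarrow> ideal (Q k) mpoly_ring" and sub: "(\<Inter>k\<in>K. Q k) \<subseteq> P"
  obtains k where "k \<in> K" "Q k \<subseteq> P"
proof -
  have "\<exists>k\<in>K. Q k \<subseteq> P"
    using K Q sub
  proof (induction K)
    case empty
    then show ?case using P by (auto simp: primeideal_mpoly_iff)
  next
    case (insert k K)
    show ?case
    proof (rule ccontr)
      assume no: "\<not> ?case"
      then obtain f where f: "f \<in> Q k" "f \<notin> P" by blast
      have "\<not> (\<Inter>k\<in>K. Q k) \<subseteq> P"
        using insert.IH insert.prems(1) no by blast
      then obtain g where g: "\<And>j. j \<in> K \<Longrightarrow> g \<in> Q j" "g \<notin> P" by blast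
      have "g * f \<in> Q k"
        using insert.prems(1)[of k] f(1) by (simp add: ideal_mpoly_iff)
      moreover have "g * f \<in> Q j" if "j \<in> K" for j
        using insert.prems(1)[of j] g(1)[OF that] that
        by (simp add: ideal_mpoly_iff mult.commute[of g])
      ultimately have "g * f \<in> P" using insert.prems(2) by blast
      then show False using P f(2) g(2) unfolding primeideal_mpoly_iff by blast
    qed
  qed
  then show thesis using that by blast
qed

lemma ideal_colon:
  fixes I :: "('n, 'k::field) mpoly set"
  assumes "ideal I mpoly_ring"
  shows "ideal (colon I f) mpoly_ring"
  using assms by (simp add: ideal_mpoly_iff colon_def distrib_right mult.assoc)

text \<open>The colon ideal of an intersection is the intersection of the colon ideals. A prime which is a
finite intersection of ideals is equal to one of them, for the same element \<open>f\<close>.\<close>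

lemma associated_primes_finite_Inter:
  fixes Q :: "'i \<Rightarrow> ('n, 'k::field) mpoly set"
  assumes K: "finite K" and Q: "\<And>k. k \<in> K \<Longrightarrow> ideal (Q k) mpoly_ring"
    and P: "P \<in> associated_primes mpoly_ring (\<Inter>k\<in>K. Q k)"
  obtains k where "k \<in> K" "P \<in> associated_primes mpoly_ring (Q k)"
proof -
  obtain f where prime: "primeideal P mpoly_ring" and f: "P = colon (\<Inter>k\<in>K. Q k) f"
    using P by (auto simp: associated_primes_eq)
  then have eq: "P = (\<Inter>k\<in>K. colon (Q k) f)" by (auto simp: colon_def)
  obtain k where k: "k \<in> K" "colon (Q k) f \<subseteq> P"
    using prime_contains_finite_Inter[OF prime K, of "\<lambda>k. colon (Q k) f"] ideal_colon Q eq by blast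
  then have "P = colon (Q k) f" using eq by blast
  then have "P \<in> associated_primes mpoly_ring (Q k)"
    using prime by (auto simp: associated_primes_eq)
  then show thesis using that k by blast
qed

text \<open>Maximizing the coordinates one after another singles out \<open>u\<close> in \<open>F\<close> and \<open>w\<close> in \<open>G\<close>: if
\<open>u' + w' = u + w\<close>, then \<open>u'\<close> and \<open>w'\<close> have to attain the same maxima.
This is the usual leading term argument, without choosing an order on the variables.\<close>

lemma unique_sum_pair:
  fixes F G :: "('n::finite \<Rightarrow>\<^sub>0 nat) set"
  assumes "finite F" "F \<noteq> {}" "finite G" "G \<noteq> {}"
  obtains u w where "u \<in> F" "w \<in> G"
    "\<And>u' w'. u' \<in> F \<Longrightarrow> w' \<in> G \<Longrightarrow> u' + w' = u + w \<Longrightarrow> u' = u \<and> w' = w"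
proof -
  have "\<exists>u\<in>F. \<exists>w\<in>G. \<forall>u'\<in>F. \<forall>w'\<in>G. u' + w' = u + w \<longrightarrow> (\<forall>i\<in>V. expo u' i = expo u i)"
    if "finite V" for V
    using that assms
  proof (induction V arbitrary: F G)
    case empty
    then show ?case by auto
  next
    case (insert i V)
    define a where "a = Max ((\<lambda>u. expo u i) ` F)"
    define b where "b = Max ((\<lambda>w. expo w i) ` G)"
    have a: "expo u i \<le> a" if "u \<in> F" for u using that insert.prems by (simp add: a_def)
    have b: "expo w i \<le> b" if "w \<in> G" for w using that insert.prems by (simp add: b_def)
    have "a \<in> (\<lambda>u. expo u i) ` F" "b \<in> (\<lambda>w. expo w i) ` G"
      unfolding a_def b_def using insert.prems by (intro Max_in; simp)+
    then have ne: "{u \<in> F. expo u i = a} \<noteq> {}" (is "?F \<noteq> _") "{w \<in> G. expo w i = b} \<noteq> {}" (is "?G \<noteq> _")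
      by auto
    have "\<exists>u\<in>?F. \<exists>w\<in>?G. \<forall>u'\<in>?F. \<forall>w'\<in>?G. u' + w' = u + w \<longrightarrow> (\<forall>j\<in>V. expo u' j = expo u j)"
      by (rule insert.IH[OF _ ne(1) _ ne(2)]) (use insert.prems in simp_all)
    then obtain u w where uw0: "u \<in> ?F" "w \<in> ?G"
      and *: "\<forall>u'\<in>?F. \<forall>w'\<in>?G. u' + w' = u + w \<longrightarrow> (\<forall>j\<in>V. expo u' j = expo u j)"
      by (elim bexE)
    from uw0 have uw: "u \<in> F" "expo u i = a" "w \<in> G" "expo w i = b" by auto
    have "\<forall>j\<in>insert i V. expo u' j = expo u j"
      if "u' \<in> F" "w' \<in> G" "u' + w' = u + w" for u' w'
    proof -
      have "expo u' i + expo w' i = a + b" using that(3) uw by (metis lookup_add)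
      then have "expo u' i = a" "expo w' i = b" using a[OF that(1)] b[OF that(2)] by auto
      then have "u' \<in> ?F" "w' \<in> ?G" using that by auto
      then have "\<forall>j\<in>V. expo u' j = expo u j" using * that(3) by blast
      then show ?thesis using \<open>expo u' i = a\<close> uw by simp
    qed
    then show ?case using uw by blast
  qed
  from this[OF finite_UNIV] obtain u w where uw: "u \<in> F" "w \<in> G"
    and *: "\<forall>u'\<in>F. \<forall>w'\<in>G. u' + w' = u + w \<longrightarrow> (\<forall>i\<in>UNIV. expo u' i = expo u i)"
    by (elim bexE)
  show thesis
  proof (rule that[OF uw])
    fix u' w' assume "u' \<in> F" "w' \<in> G" and eq: "u' + w' = u + w"
    then have "u' = u" using * by (intro poly_mapping_eqI) blast
    then show "u' = u \<and> w' = w" using eq by simp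
  qed
qed

lemma lookup_mult_unique_pair:
  fixes f g :: "('n, 'k::field) mpoly"
  assumes "\<And>u' w'. u' \<in> Poly_Mapping.keys f \<Longrightarrow> w' \<in> Poly_Mapping.keys g \<Longrightarrow> u' + w' = u + w \<Longrightarrow>
    u' = u \<and> w' = w"
  shows "Poly_Mapping.lookup (f * g) (u + w) = Poly_Mapping.lookup f u * Poly_Mapping.lookup g w"
proof -
  define f' where "f' = f - Poly_Mapping.single u (Poly_Mapping.lookup f u)"
  define g' where "g' = g - Poly_Mapping.single w (Poly_Mapping.lookup g w)"
  have keys: "Poly_Mapping.keys f' = Poly_Mapping.keys f - {u}"
      "Poly_Mapping.keys g' = Poly_Mapping.keys g - {w}"
    by (auto simp: f'_def g'_def in_keys_iff lookup_minus lookup_single when_def split: if_splits)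
  have "f * g = Poly_Mapping.single (u + w) (Poly_Mapping.lookup f u * Poly_Mapping.lookup g w)
      + Poly_Mapping.single u (Poly_Mapping.lookup f u) * g' + f' * g"
    by (simp add: f'_def g'_def algebra_simps mult_single)
  moreover have "u + w \<notin> Poly_Mapping.keys (Poly_Mapping.single u (Poly_Mapping.lookup f u) * g')"
  proof
    assume "u + w \<in> Poly_Mapping.keys (Poly_Mapping.single u (Poly_Mapping.lookup f u) * g')"
    then obtain a b where "u + w = a + b" "b \<in> Poly_Mapping.keys g'"
      "a \<in> Poly_Mapping.keys (Poly_Mapping.single u (Poly_Mapping.lookup f u))"
      using keys_mult by blast
    then show False using keys by (auto split: if_splits)
  qed
  moreover have "u + w \<notin> Poly_Mapping.keys (f' * g)"
  proof
    assume "u + w \<in> Poly_Mapping.keys (f' * g)"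
    then obtain a b where "u + w = a + b" "a \<in> Poly_Mapping.keys f'" "b \<in> Poly_Mapping.keys g"
      using keys_mult by blast
    then show False using keys assms[of a b] by auto
  qed
  ultimately show ?thesis by (simp add: lookup_add in_keys_iff)
qed

text \<open>The polynomials whose terms all have degree at least \<open>a\<close> in the variables of \<open>A\<close>; this is the
\<open>a\<close>-th power of the ideal generated by \<open>A\<close>, as shown in \<open>var_ideal_power\<close>.\<close>

definition order_ideal :: "'n::finite set \<Rightarrow> nat \<Rightarrow> ('n, 'k::field) mpoly set" where
  "order_ideal A a = polys_on {u. a \<le> partial_degree A u}"

lemma upclosed_partial_degree [simp]: "upclosed {u. a \<le> partial_degree A u}"
  by (auto simp: upclosed_def partial_degree_add)

lemma ideal_order_ideal: "ideal (order_ideal A a :: ('n::finite, 'k::field) mpoly set) mpoly_ring"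
  unfolding order_ideal_def by (intro ideal_polys_on upclosed_partial_degree)

lemma not_mem_order_ideal_iff:
  "f \<notin> order_ideal A a \<longleftrightarrow> (\<exists>u\<in>Poly_Mapping.keys f. partial_degree A u < a)"
  by (auto simp: order_ideal_def polys_on_def subset_iff not_le)

text \<open>Among the terms of \<open>f\<close> of least degree in \<open>A\<close>, and those of \<open>g\<close> of degree 0 in \<open>A\<close>, there
is a pair whose product cannot cancel.\<close>

lemma order_ideal_primary:
  fixes f g :: "('n::finite, 'k::field) mpoly"
  assumes f: "f \<notin> order_ideal A a" and g: "g \<notin> order_ideal A 1"
  shows "g * f \<notin> order_ideal A a"
proof -
  obtain u0 where u0: "u0 \<in> Poly_Mapping.keys f" "partial_degree A u0 < a"
    using f by (auto simp: not_mem_order_ideal_iff)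
  define k where "k = Min (partial_degree A ` Poly_Mapping.keys f)"
  have k_le: "k \<le> partial_degree A u" if "u \<in> Poly_Mapping.keys f" for u
    using that by (simp add: k_def)
  have "k \<in> partial_degree A ` Poly_Mapping.keys f"
    unfolding k_def using u0 by (intro Min_in) auto
  then have F: "{u \<in> Poly_Mapping.keys f. partial_degree A u = k} \<noteq> {}" (is "?F \<noteq> {}") by auto
  have G: "{w \<in> Poly_Mapping.keys g. partial_degree A w = 0} \<noteq> {}" (is "?G \<noteq> {}")
    using g by (auto simp: not_mem_order_ideal_iff)
  obtain w u where wu: "w \<in> ?G" "u \<in> ?F"
    and unique: "\<And>w' u'. w' \<in> ?G \<Longrightarrow> u' \<in> ?F \<Longrightarrow> w' + u' = w + u \<Longrightarrow> w' = w \<and> u' = u"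
    using unique_sum_pair[OF _ G _ F] by auto
  have "Poly_Mapping.lookup (g * f) (w + u) = Poly_Mapping.lookup g w * Poly_Mapping.lookup f u"
  proof (rule lookup_mult_unique_pair)
    fix w' u' assume *: "w' \<in> Poly_Mapping.keys g" "u' \<in> Poly_Mapping.keys f" "w' + u' = w + u"
    have "partial_degree A w' + partial_degree A u' = k"
      using arg_cong[OF *(3), of "partial_degree A"] wu by (simp add: partial_degree_add)
    then have "partial_degree A w' = 0" "partial_degree A u' = k" using k_le[OF *(2)] by auto
    then show "w' = w \<and> u' = u" using unique * by blast
  qed
  then have "w + u \<in> Poly_Mapping.keys (g * f)" using wu by (simp add: in_keys_iff)
  moreover have "partial_degree A (w + u) < a"
    using wu u0 k_le[OF u0(1)] by (simp add: partial_degree_add)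
  ultimately show ?thesis by (auto simp: not_mem_order_ideal_iff)
qed

lemma one_mem_order_ideal_iff: "(1 :: ('n::finite, 'k::field) mpoly) \<in> order_ideal A a \<longleftrightarrow> a = 0"
  by (simp add: order_ideal_def polys_on_def partial_degree_def)

lemma primeideal_order_ideal: "primeideal (order_ideal A 1 :: ('n::finite, 'k::field) mpoly set) mpoly_ring"
  unfolding primeideal_mpoly_iff
  using ideal_order_ideal order_ideal_primary one_mem_order_ideal_iff by (metis one_neq_zero)

lemma order_ideal_subset_prime:
  fixes P :: "('n::finite, 'k::field) mpoly set"
  assumes P: "ideal P mpoly_ring" and A: "\<And>i. i \<in> A \<Longrightarrow> xmon (var i) \<in> P"
  shows "order_ideal A 1 \<subseteq> P"
proof
  fix f :: "('n, 'k) mpoly" assume f: "f \<in> order_ideal A 1"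
  show "f \<in> P"
  proof (rule mem_ideal_if_terms[OF P])
    fix u assume "u \<in> Poly_Mapping.keys f"
    then have "partial_degree A u \<noteq> 0" using f by (auto simp: order_ideal_def polys_on_def)
    then obtain i where i: "i \<in> A" "0 < expo u i" by (auto simp: partial_degree_eq_0_iff)
    have "u = (u - var i) + var i"
      using i by (intro poly_mapping_eqI) (auto simp: expo_exchange)
    then have "xmon u = (xmon (u - var i) * xmon (var i) :: ('n, 'k) mpoly)"
      by (simp add: xmon_def mult_single)
    moreover have "(xmon (u - var i) * xmon (var i) :: ('n, 'k) mpoly) \<in> P"
      using P A[OF i(1)] by (simp add: ideal_mpoly_iff)
    ultimately show "(xmon u :: ('n, 'k) mpoly) \<in> P" by simp
  qed
qed

text \<open>A primary ideal has at most one associated prime. The prime contains a power of every variable in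
\<open>A\<close>, since it contains the ideal, and nothing outside the ideal generated by \<open>A\<close>, since the power is primary.\<close>

lemma associated_prime_order_ideal:
  fixes P :: "('n::finite, 'k::field) mpoly set"
  assumes "P \<in> associated_primes mpoly_ring (order_ideal A a)"
  shows "P = order_ideal A 1"
proof -
  obtain f where prime: "primeideal P mpoly_ring" and P: "P = colon (order_ideal A a) f"
    using assms by (auto simp: associated_primes_eq)
  have "1 \<notin> P" using prime by (simp add: primeideal_mpoly_iff)
  then have f: "f \<notin> order_ideal A a" by (simp add: P colon_def)
  have "order_ideal A 1 \<subseteq> P"
  proof (rule order_ideal_subset_prime)
    show "ideal P mpoly_ring" using prime by (simp add: primeideal_mpoly_iff)
    fix i assume i: "i \<in> A"
    have "xmon (Poly_Mapping.single i a) \<in> (order_ideal A a :: ('n, 'k) mpoly set)"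
      using i by (simp add: order_ideal_def partial_degree_single)
    then have "f * xmon (Poly_Mapping.single i a) \<in> order_ideal A a"
      using ideal_order_ideal[of A a, where ?'k = 'k] unfolding ideal_mpoly_iff by blast
    then have "xmon (Poly_Mapping.single i a) \<in> P"
      by (simp add: P colon_def mult.commute)
    then obtain j where "0 < expo (Poly_Mapping.single i a) j" "xmon (var j) \<in> P"
      using prime_contains_var[OF prime] by blast
    then show "xmon (var i) \<in> P" by (auto simp: lookup_single when_def split: if_splits)
  qed
  moreover have "P \<subseteq> order_ideal A 1"
    using order_ideal_primary[OF f] by (auto simp: P colon_def)
  ultimately show ?thesis by blast
qed

lemma order_ideal_psubset:
  assumes "C \<subset> A"
  shows "(order_ideal C 1 :: ('n::finite, 'k::field) mpoly set) \<subset> order_ideal A 1"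
proof -
  obtain i where i: "i \<in> A" "i \<notin> C" using assms by blast
  have "(order_ideal C 1 :: ('n, 'k) mpoly set) \<subseteq> order_ideal A 1"
    using partial_degree_subset[of C A] assms le_trans
    unfolding order_ideal_def polys_on_def by blast
  moreover have "xmon (var i) \<in> (order_ideal A 1 :: ('n, 'k) mpoly set)"
    "xmon (var i) \<notin> (order_ideal C 1 :: ('n, 'k) mpoly set)"
    using i by (simp_all add: order_ideal_def partial_degree_single)
  ultimately show ?thesis by blast
qed

section \<open>Associated primes of monomial ideals\<close>

lemma keys_mult_xmon:
  fixes f :: "('n, 'k::field) mpoly"
  shows "Poly_Mapping.keys (f * xmon w) = (\<lambda>u. u + w) ` Poly_Mapping.keys f"
proof -
  have coeff: "Poly_Mapping.lookup (f * xmon w) (u + w) = Poly_Mapping.lookup f u" for u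
    by (subst lookup_mult_unique_pair) (auto simp: xmon_def)
  have "Poly_Mapping.keys (f * xmon w) \<subseteq> range (\<lambda>u. u + w)"
    using keys_mult[of f "xmon w"] by auto
  then show ?thesis using coeff by (auto simp: in_keys_iff)
qed

text \<open>The hypotheses say that \<open>U : w\<close> consists of the monomials which involve a variable of \<open>A\<close>.\<close>

lemma order_ideal_associated:
  fixes U :: "('n::finite \<Rightarrow>\<^sub>0 nat) set"
  assumes U: "upclosed U" and A: "\<And>i. i \<in> A \<Longrightarrow> w + var i \<in> U"
    and off: "\<And>z. (\<And>i. i \<in> A \<Longrightarrow> expo z i = 0) \<Longrightarrow> w + z \<notin> U"
  shows "(order_ideal A 1 :: ('n, 'k::field) mpoly set) \<in> associated_primes mpoly_ring (polys_on U)"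
proof -
  have "u + w \<in> U \<longleftrightarrow> 1 \<le> partial_degree A u" for u
  proof
    assume "u + w \<in> U"
    then show "1 \<le> partial_degree A u"
      using off[of u] by (metis add.commute less_one not_le partial_degree_eq_0_iff)
  next
    assume "1 \<le> partial_degree A u"
    then have "partial_degree A u \<noteq> 0" by simp
    then obtain i where i: "i \<in> A" "0 < expo u i" by (auto simp: partial_degree_eq_0_iff)
    then have "u + w = (w + var i) + (u - var i)"
      by (intro poly_mapping_eqI) (auto simp: lookup_add lookup_minus lookup_single when_def)
    then show "u + w \<in> U" using A[OF i(1)] U unfolding upclosed_def by metis
  qed
  then have "colon (polys_on U) (xmon w) = (order_ideal A 1 :: ('n, 'k) mpoly set)"
    by (auto simp: colon_def polys_on_def order_ideal_def keys_mult_xmon)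
  then show ?thesis
    using primeideal_order_ideal by (auto simp: associated_primes_eq)
qed

text \<open>Take \<open>w\<close> of maximal degree among the multiples of \<open>u\<close> outside the ideal which exceed \<open>u\<close> by
at most \<open>d\<close> in each variable, and let \<open>A\<close> collect the variables that carry \<open>w\<close> into the
ideal. The others are stopped only by the bound, so \<open>w\<close> has exponent at least \<open>d\<close> there, and
multiplying \<open>w\<close> by them never leads into the ideal.\<close>

lemma associated_prime_above:
  fixes B :: "('n::finite \<Rightarrow>\<^sub>0 nat) set"
  assumes bound: "\<And>v i. v \<in> B \<Longrightarrow> expo v i \<le> d" and u: "u \<notin> multiples B"
  obtains A w where "mono_dvd u w" "w \<notin> multiples B" "\<And>i. i \<notin> A \<Longrightarrow> d \<le> expo w i"
    "\<And>i. i \<in> A \<Longrightarrow> w + var i \<in> multiples B" "cover B A"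
    "(order_ideal A 1 :: ('n, 'k::field) mpoly set) \<in> associated_primes mpoly_ring (polys_on (multiples B))"
proof -
  define ok where "ok w \<longleftrightarrow> mono_dvd u w \<and> w \<notin> multiples B \<and> (\<forall>i. expo w i \<le> expo u i + d)" for w
  have "ok u" using u by (simp add: ok_def)
  moreover have "\<forall>w. ok w \<longrightarrow> mono_degree w < Suc (\<Sum>i\<in>UNIV. expo u i + d)"
    unfolding ok_def mono_degree_def by (auto intro!: sum_mono le_imp_less_Suc)
  ultimately obtain w where w: "ok w" and max: "\<And>w'. ok w' \<Longrightarrow> mono_degree w' \<le> mono_degree w"
    using ex_has_greatest_nat[of ok u mono_degree] by (metis less_imp_le)
  define A where "A = {i. w + var i \<in> multiples B}"
  have big: "d \<le> expo w i" if "i \<notin> A" for i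
  proof -
    have "\<not> ok (w + var i)"
      using max[of "w + var i"] by (auto simp: mono_degree_eq partial_degree_add partial_degree_single)
    moreover have "mono_dvd u (w + var i)" "w + var i \<notin> multiples B"
      using w that mono_dvd_trans[OF _ mono_dvd_add] by (auto simp: ok_def A_def)
    ultimately obtain j where "\<not> expo (w + var i) j \<le> expo u j + d" by (auto simp: ok_def)
    then have "\<not> expo w i + 1 \<le> expo u i + d"
      using w by (auto simp: ok_def lookup_add lookup_single when_def split: if_splits)
    then show ?thesis by simp
  qed
  have off: "w + z \<notin> multiples B" if z: "\<And>i. i \<in> A \<Longrightarrow> expo z i = 0" for z
  proof
    assume "w + z \<in> multiples B"
    then obtain v where v: "v \<in> B" "mono_dvd v (w + z)" by (auto simp: multiples_def)
    have "expo v i \<le> expo w i" for i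
    proof (cases "i \<in> A")
      case True
      have "expo v i \<le> expo w i + expo z i" using v(2) by (simp add: mono_dvd_def lookup_add)
      then show ?thesis using z[OF True] by simp
    next
      case False then show ?thesis using big[OF False] bound[OF v(1), of i] by simp
    qed
    then have "w \<in> multiples B" using v(1) by (auto simp: mono_dvd_def multiples_def)
    then show False using w by (simp add: ok_def)
  qed
  have "cover B A"
    unfolding cover_def
  proof (intro ballI, rule ccontr)
    fix v assume v: "v \<in> B" "\<not> 0 < partial_degree A v"
    then have "w + v \<notin> multiples B" by (intro off) (simp add: partial_degree_eq_0_iff)
    moreover have "mono_dvd v (w + v)" by (simp add: mono_dvd_def lookup_add)
    ultimately show False using v(1) by (auto simp: multiples_def)
  qed
  moreover have "(order_ideal A 1 :: ('n, 'k) mpoly set) \<in>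
      associated_primes mpoly_ring (polys_on (multiples B))"
    using off by (intro order_ideal_associated) (auto simp: A_def)
  ultimately show thesis
    using that[of w A] w big by (auto simp: ok_def A_def)
qed

text \<open>Applied to a monomial with large exponents outside \<open>C\<close> and none in \<open>C\<close>, the previous lemma yields a cover
inside \<open>C\<close>.\<close>

lemma min_cover_associated:
  fixes B :: "('n::finite \<Rightarrow>\<^sub>0 nat) set"
  assumes bound: "\<And>v i. v \<in> B \<Longrightarrow> expo v i \<le> d" and C: "min_cover B C"
  shows "(order_ideal C 1 :: ('n, 'k::field) mpoly set) \<in> associated_primes mpoly_ring (polys_on (multiples B))"
proof -
  let ?u = "mon_of (\<lambda>i. if i \<in> C then 0 else d)"
  have u: "?u \<notin> multiples B"
  proof
    assume "?u \<in> multiples B"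
    then obtain v where v: "v \<in> B" "mono_dvd v ?u" by (auto simp: multiples_def)
    have "expo v i = 0" if "i \<in> C" for i
    proof -
      have "expo v i \<le> expo ?u i" using v(2) unfolding mono_dvd_def by blast
      then show ?thesis using that by simp
    qed
    then have "partial_degree C v = 0" by (simp add: partial_degree_eq_0_iff)
    then show False using C v(1) by (auto simp: min_cover_def cover_def)
  qed
  obtain A w where w: "mono_dvd ?u w" "w \<notin> multiples B"
    "\<And>i. i \<in> A \<Longrightarrow> w + var i \<in> multiples B" and A: "cover B A"
    and ass: "(order_ideal A 1 :: ('n, 'k) mpoly set) \<in> associated_primes mpoly_ring (polys_on (multiples B))"
    using associated_prime_above[where ?'k = 'k, OF bound u] by metis
  have "A \<subseteq> C"
  proof (rule ccontr)
    assume "\<not> A \<subseteq> C"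
    then obtain i where i: "i \<in> A" "i \<notin> C" by blast
    then obtain v where v: "v \<in> B" "mono_dvd v (w + var i)" using w(3) by (auto simp: multiples_def)
    have "expo ?u i \<le> expo w i" using w(1) unfolding mono_dvd_def by blast
    then have "expo v i \<le> expo w i" using bound[OF v(1), of i] i by simp
    moreover have "expo v j \<le> expo w j" if "j \<noteq> i" for j
      using v(2) that by (auto simp: mono_dvd_def lookup_add lookup_single when_def dest: spec[of _ j])
    ultimately have "mono_dvd v w" by (metis mono_dvd_def)
    then show False using v(1) w(2) by (auto simp: multiples_def)
  qed
  then have "A = C" using A C by (auto simp: min_cover_def)
  then show ?thesis using ass by simp
qed

lemma prime_contains_min_cover:
  fixes P :: "('n::finite, 'k::field) mpoly set"
  assumes P: "primeideal P mpoly_ring" and sub: "polys_on (multiples B) \<subseteq> P"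
  obtains C where "min_cover B C" "order_ideal C 1 \<subseteq> P"
proof -
  let ?A = "{i. xmon (var i) \<in> P}"
  have "cover B ?A"
    unfolding cover_def
  proof
    fix v assume "v \<in> B"
    then have "xmon v \<in> P" using sub subset_multiples[of B] by fastforce
    then obtain i where "0 < expo v i" "xmon (var i) \<in> P" using prime_contains_var[OF P] by blast
    then show "0 < partial_degree ?A v" using expo_le_partial_degree[of i ?A v] by simp
  qed
  then obtain C where "C \<subseteq> ?A" "min_cover B C" using cover_contains_min_cover by blast
  then show thesis
    using that order_ideal_subset_prime[of P C] P by (auto simp: primeideal_mpoly_iff)
qed

section \<open>Finiteness of the height of a prime\<close>

text \<open>More polynomials than available monomials are linearly dependent. The family may repeat a polynomial,
whence the case distinction.\<close>

lemma exists_linear_relation: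
  fixes p :: "'i \<Rightarrow> ('n, 'k::field) mpoly"
  assumes E: "finite E" and M: "finite M" and keys: "\<And>a. a \<in> E \<Longrightarrow> Poly_Mapping.keys (p a) \<subseteq> M"
    and card: "card M < card E"
  obtains c where "\<exists>a\<in>E. c a \<noteq> 0" "(\<Sum>a\<in>E. Poly_Mapping.single 0 (c a) * p a) = 0"
proof (cases "inj_on p E")
  case False
  then obtain a b where ab: "a \<in> E" "b \<in> E" "a \<noteq> b" "p a = p b" by (auto simp: inj_on_def)
  let ?c = "\<lambda>x. if x = a then 1 else if x = b then - 1 else (0 :: 'k)"
  have "(\<Sum>x\<in>E. Poly_Mapping.single 0 (?c x) * p x) = (\<Sum>x\<in>{a, b}. Poly_Mapping.single 0 (?c x) * p x)"
    using E ab by (intro sum.mono_neutral_right) auto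
  also have "\<dots> = 0" using ab by (simp add: single_uminus)
  finally show thesis using that[of ?c] ab by fastforce
next
  case True
  interpret V: vector_space "\<lambda>(c :: 'k) (f :: ('n, 'k) mpoly). Poly_Mapping.single 0 c * f"
    by unfold_locales (simp_all add: distrib_left distrib_right single_add mult_single flip: mult.assoc)
  have "p ` E \<subseteq> V.span (xmon ` M)"
  proof
    fix f assume "f \<in> p ` E"
    then have f: "Poly_Mapping.keys f \<subseteq> M" using keys by blast
    have "Poly_Mapping.single u (Poly_Mapping.lookup f u) \<in> V.span (xmon ` M)"
      if "u \<in> Poly_Mapping.keys f" for u
    proof -
      have "Poly_Mapping.single 0 (Poly_Mapping.lookup f u) * xmon u \<in> V.span (xmon ` M)"
        using f that by (intro V.span_scale V.span_base) auto
      then show ?thesis by (simp add: xmon_def mult_single)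
    qed
    then show "f \<in> V.span (xmon ` M)"
      by (subst poly_eq_sum_of_terms) (rule V.span_sum)
  qed
  moreover have "card (xmon ` M :: ('n, 'k) mpoly set) < card (p ` E)"
    using card_image_le[OF M, of "xmon :: _ \<Rightarrow> ('n, 'k) mpoly"] card True by (simp add: card_image)
  ultimately have "V.dependent (p ` E)"
    using V.independent_span_bound[of "xmon ` M" "p ` E"] M by fastforce
  then obtain u f where "f \<in> p ` E" "u f \<noteq> 0" "(\<Sum>f\<in>p ` E. Poly_Mapping.single 0 (u f) * f) = 0"
    using V.dependent_finite[of "p ` E"] E by auto
  then show thesis
    using that[of "u \<circ> p"] True by (auto simp: sum.reindex)
qed

text \<open>For each step of a chain of primes choose \<open>f (Suc i)\<close> in the larger one but not in the smaller. The claim is that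
these elements are algebraically independent modulo \<open>Q 0\<close>. In a relation modulo \<open>Q n\<close>, the largest common
power of \<open>f (Suc n)\<close> can be cancelled, because it is not in the prime \<open>Q n\<close>. Modulo
\<open>Q (Suc n)\<close> the terms still containing \<open>f (Suc n)\<close> then vanish, leaving a shorter relation between the
remaining elements. The set \<open>E\<close> of exponents is only required to be determined on the indices in
use, so that it need not be reindexed when an index is dropped.\<close>

lemma prime_chain_independent:
  fixes Q :: "nat \<Rightarrow> ('n, 'k::field) mpoly set"
  assumes prime: "\<And>i. i \<le> r \<Longrightarrow> primeideal (Q i) mpoly_ring"
    and f: "\<And>i. i < r \<Longrightarrow> f (Suc i) \<in> Q (Suc i) - Q i"
    and mono: "\<And>i. i < r \<Longrightarrow> Q i \<subseteq> Q (Suc i)"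
    and E: "finite E" "\<And>a b. a \<in> E \<Longrightarrow> b \<in> E \<Longrightarrow> (\<And>i. i \<in> {0<..r} \<Longrightarrow> a i = b i) \<Longrightarrow> a = b"
    and relation: "(\<Sum>a\<in>E. Poly_Mapping.single 0 (c a) * (\<Prod>i\<in>{0<..r}. f i ^ a i)) \<in> Q 0"
  shows "\<forall>a\<in>E. c a = 0"
proof -
  define claim where "claim n \<longleftrightarrow> (\<forall>E. finite E \<longrightarrow>
      (\<forall>a\<in>E. \<forall>b\<in>E. (\<forall>i\<in>{n<..r}. a i = b i) \<longrightarrow> a = b) \<longrightarrow>
      (\<Sum>a\<in>E. Poly_Mapping.single 0 (c a) * (\<Prod>i\<in>{n<..r}. f i ^ a i)) \<in> Q n \<longrightarrow>
      (\<forall>a\<in>E. c a = 0))" for n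
  have "claim 0"
  proof (rule inc_induct[of 0 r claim])
    show "claim r"
      unfolding claim_def
    proof (intro allI impI ballI, rule ccontr)
      fix E a assume "finite E" "\<forall>a\<in>E. \<forall>b\<in>E. (\<forall>i\<in>{r<..r}. a i = b i) \<longrightarrow> a = b"
        and rel: "(\<Sum>a\<in>E. Poly_Mapping.single 0 (c a) * (\<Prod>i\<in>{r<..r}. f i ^ a i)) \<in> Q r"
        and a: "a \<in> E" and ca: "c a \<noteq> 0"
      then have "E = {a}" by auto
      then have "Poly_Mapping.single 0 (c a) \<in> Q r" using rel by simp
      then have "Poly_Mapping.single 0 (1 / c a) * Poly_Mapping.single 0 (c a) \<in> Q r"
        using prime[of r] by (simp add: primeideal_mpoly_iff ideal_mpoly_iff)
      then have "1 \<in> Q r" using ca by (simp add: mult_single)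
      then show False using prime[of r] by (simp add: primeideal_mpoly_iff)
    qed
  next
    fix n assume n: "n < r" and IH: "claim (Suc n)"
    show "claim n"
      unfolding claim_def
    proof (intro allI impI ballI, rule ccontr)
      fix E a0 assume E: "finite E" "\<forall>a\<in>E. \<forall>b\<in>E. (\<forall>i\<in>{n<..r}. a i = b i) \<longrightarrow> a = b"
        and rel: "(\<Sum>a\<in>E. Poly_Mapping.single 0 (c a) * (\<Prod>i\<in>{n<..r}. f i ^ a i)) \<in> Q n"
        and a0: "a0 \<in> E" "c a0 \<noteq> 0"
      define g where "g = f (Suc n)"
      define p where "p a = (\<Prod>i\<in>{Suc n<..r}. f i ^ a i)" for a
      have I: "ideal (Q n) mpoly_ring" "ideal (Q (Suc n)) mpoly_ring"
        and Pn: "\<And>h h'. h * h' \<in> Q n \<Longrightarrow> h \<in> Q n \<or> h' \<in> Q n"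
        using prime[of n] prime[of "Suc n"] n by (simp_all add: primeideal_mpoly_iff)
      have g: "g \<in> Q (Suc n)" "g \<notin> Q n" using f[OF n] by (simp_all add: g_def)
      have split: "(\<Prod>i\<in>{n<..r}. f i ^ a i) = g ^ a (Suc n) * p a" for a
      proof -
        have "{n<..r} = insert (Suc n) {Suc n<..r}" using n by auto
        then show ?thesis by (simp add: p_def g_def)
      qed
      define E' where "E' = {a \<in> E. c a \<noteq> 0}"
      \<comment> \<open>The largest power of \<open>g\<close> dividing all terms of the relation.\<close>
      define k where "k = Min ((\<lambda>a. a (Suc n)) ` E')"
      have E': "finite E'" "E' \<noteq> {}" using E a0 by (auto simp: E'_def)
      have k_le: "k \<le> a (Suc n)" if "a \<in> E'" for a using that E' by (simp add: k_def)
      have "k \<in> (\<lambda>a. a (Suc n)) ` E'" unfolding k_def using E' by (intro Min_in) auto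
      then obtain a1 where a1: "a1 \<in> E'" "a1 (Suc n) = k" by auto
      define S where "S = (\<Sum>a\<in>E'. Poly_Mapping.single 0 (c a) * (g ^ (a (Suc n) - k) * p a))"
      have "(\<Sum>a\<in>E. Poly_Mapping.single 0 (c a) * (\<Prod>i\<in>{n<..r}. f i ^ a i)) =
          (\<Sum>a\<in>E'. Poly_Mapping.single 0 (c a) * (\<Prod>i\<in>{n<..r}. f i ^ a i))"
        using E by (intro sum.mono_neutral_right) (auto simp: E'_def)
      also have "\<dots> = g ^ k * S"
        unfolding S_def sum_distrib_left
      proof (rule sum.cong[OF refl])
        fix a assume "a \<in> E'"
        then have "g ^ a (Suc n) = g ^ k * g ^ (a (Suc n) - k)"
          using k_le by (simp flip: power_add)
        then show "Poly_Mapping.single 0 (c a) * (\<Prod>i\<in>{n<..r}. f i ^ a i) =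
            g ^ k * (Poly_Mapping.single 0 (c a) * (g ^ (a (Suc n) - k) * p a))"
          by (simp add: split mult_ac)
      qed
      finally have gS: "g ^ k * S \<in> Q n" using rel by simp
      have "h \<in> Q n" if "g ^ j * h \<in> Q n" for h j
        using that
      proof (induction j)
        case (Suc j)
        then have "g * (g ^ j * h) \<in> Q n" by (simp add: mult_ac)
        then show ?case using Pn g(2) Suc.IH by blast
      qed simp
      then have S: "S \<in> Q (Suc n)" using gS mono[OF n] by blast
      define E0 where "E0 = {a \<in> E'. a (Suc n) = k}"
      have "S = (\<Sum>a\<in>E0. Poly_Mapping.single 0 (c a) * p a)
          + (\<Sum>a\<in>E' - E0. Poly_Mapping.single 0 (c a) * (g ^ (a (Suc n) - k) * p a))"
      proof -
        have "S = (\<Sum>a\<in>E0. Poly_Mapping.single 0 (c a) * (g ^ (a (Suc n) - k) * p a))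
            + (\<Sum>a\<in>E' - E0. Poly_Mapping.single 0 (c a) * (g ^ (a (Suc n) - k) * p a))"
          unfolding S_def by (subst add.commute, rule sum.subset_diff) (auto simp: E0_def E')
        also have "(\<Sum>a\<in>E0. Poly_Mapping.single 0 (c a) * (g ^ (a (Suc n) - k) * p a)) =
            (\<Sum>a\<in>E0. Poly_Mapping.single 0 (c a) * p a)"
          by (intro sum.cong) (auto simp: E0_def)
        finally show ?thesis .
      qed
      moreover have high: "(\<Sum>a\<in>E' - E0. Poly_Mapping.single 0 (c a) * (g ^ (a (Suc n) - k) * p a)) \<in> Q (Suc n)"
      proof -
        have "Poly_Mapping.single 0 (c a) * (g ^ (a (Suc n) - k) * p a) \<in> Q (Suc n)"
          if a: "a \<in> E' - E0" for a
        proof -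
          have "k < a (Suc n)" using k_le[of a] a by (auto simp: E0_def)
          then obtain j where "a (Suc n) - k = Suc j" by (metis Suc_diff_Suc)
          then have "Poly_Mapping.single 0 (c a) * (g ^ (a (Suc n) - k) * p a) =
              (Poly_Mapping.single 0 (c a) * g ^ j * p a) * g" by (simp add: mult_ac)
          moreover have "(Poly_Mapping.single 0 (c a) * g ^ j * p a) * g \<in> Q (Suc n)"
            using I(2) g(1) unfolding ideal_mpoly_iff by blast
          ultimately show ?thesis by simp
        qed
        then have "(\<Sum>a\<in>D. Poly_Mapping.single 0 (c a) * (g ^ (a (Suc n) - k) * p a)) \<in> Q (Suc n)"
          if "D \<subseteq> E' - E0" for D
          using that I(2) by (induction D rule: infinite_finite_induct) (auto simp: ideal_mpoly_iff)
        from this[OF subset_refl] show ?thesis .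
      qed
      ultimately have low: "(\<Sum>a\<in>E0. Poly_Mapping.single 0 (c a) * p a) \<in> Q (Suc n)"
      proof -
        let ?h = "\<Sum>a\<in>E' - E0. Poly_Mapping.single 0 (c a) * (g ^ (a (Suc n) - k) * p a)"
        assume "S = (\<Sum>a\<in>E0. Poly_Mapping.single 0 (c a) * p a) + ?h"
        then have "(\<Sum>a\<in>E0. Poly_Mapping.single 0 (c a) * p a) = S + (- 1) * ?h" by simp
        moreover have "S + (- 1) * ?h \<in> Q (Suc n)"
          using I(2) S high unfolding ideal_mpoly_iff by blast
        ultimately show ?thesis by simp
      qed
      have "finite E0" using E' by (simp add: E0_def)
      moreover have "\<forall>a\<in>E0. \<forall>b\<in>E0. (\<forall>i\<in>{Suc n<..r}. a i = b i) \<longrightarrow> a = b"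
      proof (intro ballI impI)
        fix a b assume ab: "a \<in> E0" "b \<in> E0" "\<forall>i\<in>{Suc n<..r}. a i = b i"
        have "a i = b i" if "i \<in> {n<..r}" for i
          using that ab by (cases "i = Suc n") (auto simp: E0_def)
        moreover have "a \<in> E" "b \<in> E" using ab by (auto simp: E0_def E'_def)
        ultimately show "a = b" using E(2) by blast
      qed
      ultimately have "\<forall>a\<in>E0. c a = 0"
        using IH[unfolded claim_def, THEN spec, of E0] low unfolding p_def by (elim impE)
      moreover have "a1 \<in> E0" "c a1 \<noteq> 0" using a1 by (auto simp: E0_def E'_def)
      ultimately show False by blast
    qed
  qed simp
  then have "finite E \<longrightarrow> (\<forall>a\<in>E. \<forall>b\<in>E. (\<forall>i\<in>{0<..r}. a i = b i) \<longrightarrow> a = b) \<longrightarrow> (\<forall>a\<in>E. c a = 0)"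
    using relation unfolding claim_def by blast
  then show ?thesis using E by blast
qed

definition expo_bounded :: "nat \<Rightarrow> ('n, 'k::field) mpoly \<Rightarrow> bool" where
  "expo_bounded N f \<longleftrightarrow> (\<forall>u\<in>Poly_Mapping.keys f. \<forall>i. expo u i \<le> N)"

lemma expo_bounded_mult:
  fixes f g :: "('n, 'k::field) mpoly"
  assumes "expo_bounded N f" "expo_bounded N' g"
  shows "expo_bounded (N + N') (f * g)"
  unfolding expo_bounded_def
proof (intro ballI allI)
  fix u i assume "u \<in> Poly_Mapping.keys (f * g)"
  then obtain a b where "u = a + b" "a \<in> Poly_Mapping.keys f" "b \<in> Poly_Mapping.keys g"
    using keys_mult by blast
  then show "expo u i \<le> N + N'"
    using assms by (simp add: expo_bounded_def lookup_add add_mono)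
qed

lemma expo_bounded_one: "expo_bounded 0 (1 :: ('n, 'k::field) mpoly)"
  by (simp add: expo_bounded_def)

lemma expo_bounded_power: "expo_bounded N f \<Longrightarrow> expo_bounded (k * N) (f ^ k)"
  by (induction k) (simp_all add: expo_bounded_one expo_bounded_mult)

lemma expo_bounded_prod:
  "(\<And>i. i \<in> D \<Longrightarrow> expo_bounded N (f i)) \<Longrightarrow> expo_bounded (card D * N) (\<Prod>i\<in>D. f i)"
  by (induction D rule: infinite_finite_induct) (simp_all add: expo_bounded_one expo_bounded_mult)

lemma expo_bounded_mono: "expo_bounded N f \<Longrightarrow> N \<le> N' \<Longrightarrow> expo_bounded N' f"
  unfolding expo_bounded_def using le_trans by blast

lemma card_bounded_monomials:
  "finite {u :: 'n::finite \<Rightarrow>\<^sub>0 nat. \<forall>i. expo u i \<le> N}"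
  "card {u :: 'n::finite \<Rightarrow>\<^sub>0 nat. \<forall>i. expo u i \<le> N} \<le> (N + 1) ^ card (UNIV :: 'n set)"
proof -
  let ?E = "PiE (UNIV :: 'n set) (\<lambda>_. {..N})"
  have sub: "{u :: 'n \<Rightarrow>\<^sub>0 nat. \<forall>i. expo u i \<le> N} \<subseteq> mon_of ` ?E"
  proof
    fix u :: "'n \<Rightarrow>\<^sub>0 nat" assume "u \<in> {u. \<forall>i. expo u i \<le> N}"
    then have "expo u \<in> ?E" by auto
    moreover have "u = mon_of (expo u)" by (rule poly_mapping_eqI) simp
    ultimately show "u \<in> mon_of ` ?E" by blast
  qed
  have fin: "finite ?E" by (intro finite_PiE) auto
  then show "finite {u :: 'n \<Rightarrow>\<^sub>0 nat. \<forall>i. expo u i \<le> N}" using sub finite_subset by blast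
  have "card {u :: 'n \<Rightarrow>\<^sub>0 nat. \<forall>i. expo u i \<le> N} \<le> card (mon_of ` ?E)"
    using sub fin by (intro card_mono) auto
  also have "\<dots> \<le> card ?E" using fin by (rule card_image_le)
  also have "\<dots> = (N + 1) ^ card (UNIV :: 'n set)" by (simp add: card_PiE)
  finally show "card {u :: 'n \<Rightarrow>\<^sub>0 nat. \<forall>i. expo u i \<le> N} \<le> (N + 1) ^ card (UNIV :: 'n set)" .
qed

text \<open>A chain with more steps than variables would give algebraically independent polynomials, one more
than there are variables; let \<open>m\<close> be their number. Their monomials with exponents at most \<open>s\<close> are \<open>(s + 1) ^ m\<close> linearly independent
polynomials, but they live in a space whose dimension grows only like \<open>s ^ (m - 1)\<close>.\<close>

lemma prime_chain_length:
  fixes Q :: "nat \<Rightarrow> ('n::finite, 'k::field) mpoly set"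
  assumes prime: "\<And>i. i \<le> r \<Longrightarrow> primeideal (Q i) mpoly_ring"
    and strict: "\<And>i. i < r \<Longrightarrow> Q i \<subset> Q (Suc i)"
  shows "r \<le> card (UNIV :: 'n set)"
proof (rule ccontr)
  assume "\<not> r \<le> card (UNIV :: 'n set)"
  define m where "m = Suc (card (UNIV :: 'n set))"
  have m: "m \<le> r" using \<open>\<not> r \<le> card (UNIV :: 'n set)\<close> by (simp add: m_def)
  have "\<exists>f. f \<in> Q (Suc i) - Q i" if "i < m" for i using strict[of i] that m by auto
  then obtain f0 where f0: "\<And>i. i < m \<Longrightarrow> f0 i \<in> Q (Suc i) - Q i" by metis
  define f where "f i = f0 (i - 1)" for i
  have f: "f (Suc i) \<in> Q (Suc i) - Q i" if "i < m" for i using f0[OF that] by (simp add: f_def)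
  define e where "e = Max (insert 0 (\<Union>i\<in>{0<..m}. \<Union>u\<in>Poly_Mapping.keys (f i). range (expo u)))"
  have e: "expo_bounded e (f i)" if "i \<in> {0<..m}" for i
    unfolding expo_bounded_def
  proof (intro ballI allI)
    fix u k assume "u \<in> Poly_Mapping.keys (f i)"
    then have "expo u k \<in> (\<Union>i\<in>{0<..m}. \<Union>u\<in>Poly_Mapping.keys (f i). range (expo u))"
      using that by blast
    then show "expo u k \<le> e" unfolding e_def by (intro Max_ge) auto
  qed
  \<comment> \<open>Large enough for \<open>s + 1\<close> to exceed the constant factor in the comparison of the two counts.\<close>
  define s where "s = (e * m + 1) ^ card (UNIV :: 'n set)"
  define E where "E = PiE {0<..m} (\<lambda>_. {..s})"
  define p where "p a = (\<Prod>i\<in>{0<..m}. f i ^ a i)" for a :: "nat \<Rightarrow> nat"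
  define M where "M = {u :: 'n \<Rightarrow>\<^sub>0 nat. \<forall>i. expo u i \<le> e * m * s}"
  have "finite E" unfolding E_def by (intro finite_PiE) auto
  have "Poly_Mapping.keys (p a) \<subseteq> M" if a: "a \<in> E" for a
  proof -
    have "expo_bounded (s * e) (f i ^ a i)" if i: "i \<in> {0<..m}" for i
    proof (rule expo_bounded_mono[OF expo_bounded_power[OF e[OF i]]])
      have "a i \<le> s" using a i by (auto simp: E_def)
      then show "a i * e \<le> s * e" by simp
    qed
    then have "expo_bounded (card {0<..m} * (s * e)) (p a)"
      unfolding p_def by (rule expo_bounded_prod)
    then show ?thesis by (auto simp: expo_bounded_def M_def mult_ac)
  qed
  moreover have "card M < card E"
  proof -
    have "card M \<le> (e * m * s + 1) ^ card (UNIV :: 'n set)"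
      unfolding M_def by (rule card_bounded_monomials)
    also have "\<dots> \<le> ((e * m + 1) * (s + 1)) ^ card (UNIV :: 'n set)"
      by (intro power_mono) (auto simp: algebra_simps)
    also have "\<dots> = s * (s + 1) ^ card (UNIV :: 'n set)" by (simp only: power_mult_distrib s_def[symmetric])
    also have "\<dots> < (s + 1) * (s + 1) ^ card (UNIV :: 'n set)" by simp
    also have "\<dots> = card E" by (simp add: E_def card_PiE m_def)
    finally show ?thesis .
  qed
  moreover have "finite M" unfolding M_def by (rule card_bounded_monomials)
  ultimately obtain c where c: "\<exists>a\<in>E. c a \<noteq> 0" "(\<Sum>a\<in>E. Poly_Mapping.single 0 (c a) * p a) = 0"
    using exists_linear_relation[OF \<open>finite E\<close>, of M p] by blast
  have "\<forall>a\<in>E. c a = 0"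
  proof (rule prime_chain_independent[where Q = Q and f = f and r = m])
    show "primeideal (Q i) mpoly_ring" if "i \<le> m" for i using prime that m by simp
    show "f (Suc i) \<in> Q (Suc i) - Q i" if "i < m" for i using f that .
    show "Q i \<subseteq> Q (Suc i)" if "i < m" for i using strict[of i] that m by auto
    show "a = b" if "a \<in> E" "b \<in> E" "\<And>i. i \<in> {0<..m} \<Longrightarrow> a i = b i" for a b
      using that unfolding E_def by (intro PiE_ext)
    show "(\<Sum>a\<in>E. Poly_Mapping.single 0 (c a) * (\<Prod>i\<in>{0<..m}. f i ^ a i)) \<in> Q 0"
      using c(2) prime[of 0] unfolding p_def by (simp add: primeideal_mpoly_iff ideal_mpoly_iff)
  qed (fact \<open>finite E\<close>)
  then show False using c(1) by blast
qed

section \<open>Heights of comparable primes\<close>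

lemma prime_height_chain_le:
  assumes "\<And>i. i \<le> r \<Longrightarrow> primeideal (Q i) R" "\<And>i. i < r \<Longrightarrow> Q i \<subset> Q (Suc i)"
  shows "enat r \<le> prime_height R (Q r)"
  unfolding prime_height_def using assms by (intro Sup_upper) blast

lemma prime_height_mono:
  assumes P: "primeideal P R" "primeideal P' R" "P \<subseteq> P'"
  shows "prime_height R P \<le> prime_height R P'"
proof (cases "P = P'")
  case False
  show ?thesis
    unfolding prime_height_def[of R P]
  proof (rule Sup_least, clarify)
    fix r Q assume Q: "\<forall>i\<le>r. primeideal (Q i) R" "\<forall>i<r. Q i \<subset> Q (Suc i)" "P = Q r"
    define Q' where "Q' = Q(r := P')"
    have "enat r \<le> prime_height R (Q' r)"
    proof (rule prime_height_chain_le)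
      fix i assume "i \<le> r"
      then show "primeideal (Q' i) R" using Q P by (simp add: Q'_def)
    next
      fix i assume "i < r"
      then show "Q' i \<subset> Q' (Suc i)" using Q P by (auto simp: Q'_def)
    qed
    then show "enat r \<le> prime_height R P'" by (simp add: Q'_def)
  qed
qed simp

lemma ideal_height_primeideal:
  assumes "primeideal P R"
  shows "ideal_height R P = prime_height R P"
  unfolding ideal_height_def
  using assms by (intro antisym INF_lower2[of P] INF_greatest) (auto intro: prime_height_mono)

text \<open>As the lengths of chains are bounded, the height of the smaller prime is attained by a chain, which
the larger prime extends.\<close>

lemma prime_height_strict_mono:
  fixes P P' :: "('n::finite, 'k::field) mpoly set"
  assumes P: "primeideal P mpoly_ring" "primeideal P' mpoly_ring" "P \<subset> P'"
  shows "prime_height mpoly_ring P < prime_height mpoly_ring P'"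
proof -
  let ?S = "{r. \<exists>Q. (\<forall>i\<le>r. primeideal (Q i) (mpoly_ring :: ('n, 'k) mpoly ring)) \<and>
      (\<forall>i<r. Q i \<subset> Q (Suc i)) \<and> Q r = P}"
  have bound: "r \<le> card (UNIV :: 'n set)" if "r \<in> ?S" for r
  proof -
    from that obtain Q where "\<forall>i\<le>r. primeideal (Q i) (mpoly_ring :: ('n, 'k) mpoly ring)"
      "\<forall>i<r. Q i \<subset> Q (Suc i)" by blast
    then show ?thesis by (intro prime_chain_length[of r Q]) auto
  qed
  have "0 \<in> ?S" using P by auto
  define h where "h = Max ?S"
  have fin: "finite ?S" using bound by (intro finite_subset[of ?S "{..card (UNIV :: 'n set)}"]) auto
  have "h \<in> ?S" unfolding h_def using fin \<open>0 \<in> ?S\<close> by (intro Max_in) auto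
  then obtain Q where Q: "\<forall>i\<le>h. primeideal (Q i) (mpoly_ring :: ('n, 'k) mpoly ring)"
    "\<forall>i<h. Q i \<subset> Q (Suc i)" "Q h = P" by blast
  have "prime_height mpoly_ring P \<le> enat h"
    unfolding prime_height_def
  proof (rule Sup_least, clarify)
    fix r Q assume "\<forall>i\<le>r. primeideal (Q i) (mpoly_ring :: ('n, 'k) mpoly ring)"
      "\<forall>i<r. Q i \<subset> Q (Suc i)" "P = Q r"
    then have "r \<in> ?S" by blast
    then show "enat r \<le> enat h" unfolding h_def using fin by simp
  qed
  also have "enat h < enat (Suc h)" by simp
  also have "\<dots> \<le> prime_height mpoly_ring ((Q(Suc h := P')) (Suc h))"
  proof (rule prime_height_chain_le[of "Suc h" "Q(Suc h := P')"])
    fix i assume "i \<le> Suc h"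
    then show "primeideal ((Q(Suc h := P')) i) mpoly_ring" using Q P by simp
  next
    fix i assume "i < Suc h"
    then show "(Q(Suc h := P')) i \<subset> (Q(Suc h := P')) (Suc i)"
      using Q P by (cases "i = h") auto
  qed
  finally show ?thesis by simp
qed

lemma ideal_height_order_ideal:
  "ideal_height mpoly_ring (order_ideal A 1 :: ('n::finite, 'k::field) mpoly set) =
    prime_height mpoly_ring (order_ideal A 1 :: ('n, 'k) mpoly set)"
  by (rule ideal_height_primeideal[OF primeideal_order_ideal])

section \<open>Products of ideals in disjoint sets of variables\<close>

definition depends_on :: "('n \<Rightarrow>\<^sub>0 nat) set \<Rightarrow> 'n set \<Rightarrow> bool" where
  "depends_on U A \<longleftrightarrow> (\<forall>u\<in>U. \<forall>u'. (\<forall>i\<in>A. expo u' i = expo u i) \<longrightarrow> u' \<in> U)"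

text \<open>If \<open>w\<close> belongs to both sets, then the part of \<open>w\<close> in \<open>A\<close> belongs to the first set, the part outside
\<open>A\<close> to the second, and their product is \<open>w\<close>.\<close>

lemma ideal_prod_disjoint:
  fixes U V :: "('n::finite \<Rightarrow>\<^sub>0 nat) set"
  assumes U: "upclosed U" "depends_on U A" and V: "upclosed V" "depends_on V A'" and AA': "A \<inter> A' = {}"
  shows "polys_on U \<cdot>\<^bsub>mpoly_ring\<^esub> polys_on V = (polys_on (U \<inter> V) :: ('n, 'k::field) mpoly set)"
proof -
  have "{u + v | u v. u \<in> U \<and> v \<in> V} = U \<inter> V"
  proof (intro equalityI subsetI)
    fix w assume "w \<in> {u + v | u v. u \<in> U \<and> v \<in> V}"
    then obtain u v where w: "w = u + v" "w = v + u" "u \<in> U" "v \<in> V" by (auto simp: add.commute)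
    have "w \<in> U" unfolding w(1) using U(1) w(3) by (simp add: upclosed_def)
    moreover have "w \<in> V" unfolding w(2) using V(1) w(4) by (simp add: upclosed_def)
    ultimately show "w \<in> U \<inter> V" by blast
  next
    fix w assume w: "w \<in> U \<inter> V"
    let ?u = "mon_of (\<lambda>i. if i \<in> A then expo w i else 0)"
    let ?v = "mon_of (\<lambda>i. if i \<in> A then 0 else expo w i)"
    have "w = ?u + ?v" by (rule poly_mapping_eqI) (simp add: lookup_add)
    moreover have "?u \<in> U"
    proof -
      have "\<forall>i\<in>A. expo ?u i = expo w i" by simp
      then show ?thesis using U(2) w unfolding depends_on_def by blast
    qed
    moreover have "?v \<in> V"
    proof -
      have "\<forall>i\<in>A'. expo ?v i = expo w i" using AA' by auto
      then show ?thesis using V(2) w unfolding depends_on_def by blast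
    qed
    ultimately show "w \<in> {u + v | u v. u \<in> U \<and> v \<in> V}" by blast
  qed
  then show ?thesis using ideal_prod_polys_on[OF U(1) V(1)] by simp
qed

lemma var_ideal_eq: "var_ideal A = (order_ideal A 1 :: ('n::finite, 'k::field) mpoly set)"
proof -
  have "multiples (var ` A) = {u :: 'n \<Rightarrow>\<^sub>0 nat. 1 \<le> partial_degree A u}"
  proof (intro equalityI subsetI)
    fix u :: "'n \<Rightarrow>\<^sub>0 nat" assume "u \<in> multiples (var ` A)"
    then obtain i where i: "i \<in> A" "mono_dvd (var i) u" by (auto simp: multiples_def)
    have "expo (var i) i \<le> expo u i" using i(2) unfolding mono_dvd_def by blast
    then show "u \<in> {u. 1 \<le> partial_degree A u}"
      using expo_le_partial_degree[OF i(1), of u] by simp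
  next
    fix u :: "'n \<Rightarrow>\<^sub>0 nat" assume "u \<in> {u. 1 \<le> partial_degree A u}"
    then have "partial_degree A u \<noteq> 0" by simp
    then obtain i where i: "i \<in> A" "0 < expo u i" by (auto simp: partial_degree_eq_0_iff)
    then have "mono_dvd (var i) u" by (auto simp: mono_dvd_def lookup_single when_def)
    then show "u \<in> multiples (var ` A)" using i by (auto simp: multiples_def)
  qed
  then show ?thesis by (simp add: var_ideal_def monomial_span_eq order_ideal_def)
qed

lemma ideals_set_simps [simp]:
  "carrier (ideals_set R) = {I. ideal I R}"
  "I \<otimes>\<^bsub>ideals_set R\<^esub> J = I \<cdot>\<^bsub>R\<^esub> J"
  "\<one>\<^bsub>ideals_set R\<^esub> = carrier R"
  by (simp_all add: ideals_set_def)

lemma var_ideal_power: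
  "var_ideal A [^]\<^bsub>ideals_set mpoly_ring\<^esub> a = (order_ideal A a :: ('n::finite, 'k::field) mpoly set)"
proof (induction a)
  case 0
  show ?case by (auto simp: order_ideal_def polys_on_def)
next
  case (Suc a)
  have "{u + v | u v. u \<in> {u. a \<le> partial_degree A u} \<and> v \<in> {u. 1 \<le> partial_degree A u}} =
    {u :: 'n \<Rightarrow>\<^sub>0 nat. Suc a \<le> partial_degree A u}"
  proof (intro equalityI subsetI)
    fix w :: "'n \<Rightarrow>\<^sub>0 nat" assume w: "w \<in> {u. Suc a \<le> partial_degree A u}"
    then have "partial_degree A w \<noteq> 0" by auto
    then obtain i where i: "i \<in> A" "0 < expo w i" by (auto simp: partial_degree_eq_0_iff)
    have eq: "w = (w - var i) + var i"
      using i by (intro poly_mapping_eqI) (auto simp: expo_exchange)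
    have one: "partial_degree A (var i) = 1" using i by (simp add: partial_degree_single)
    have "partial_degree A w = partial_degree A (w - var i) + 1"
      using arg_cong[OF eq, of "partial_degree A"] one by (simp only: partial_degree_add)
    then have "a \<le> partial_degree A (w - var i)" using w by simp
    then show "w \<in> {u + v | u v. u \<in> {u. a \<le> partial_degree A u} \<and> v \<in> {u. 1 \<le> partial_degree A u}}"
      using eq one by (intro CollectI exI[of _ "w - var i"] exI[of _ "var i"]) simp
  qed (auto simp: partial_degree_add)
  then show ?case
    using Suc ideal_prod_polys_on[OF upclosed_partial_degree[of a A] upclosed_partial_degree[of 1 A]]
    by (simp add: var_ideal_eq order_ideal_def)
qed

lemma depends_on_order_constraints:
  "depends_on {u. \<forall>i\<in>K. a i \<le> partial_degree (A i) u} (\<Union>i\<in>K. A i)"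
  unfolding depends_on_def
proof (intro ballI allI impI, rule CollectI, rule ballI)
  fix u u' i
  assume u: "u \<in> {u. \<forall>i\<in>K. a i \<le> partial_degree (A i) u}"
    "\<forall>k\<in>\<Union>i\<in>K. A i. expo u' k = expo u k" and i: "i \<in> K"
  have "partial_degree (A i) u' = partial_degree (A i) u"
    using u(2) i by (intro partial_degree_cong) blast
  then show "a i \<le> partial_degree (A i) u'" using u(1) i by simp
qed

lemma upclosed_order_constraints: "upclosed {u. \<forall>i\<in>K. a i \<le> partial_degree (A i) u}"
  by (auto simp: upclosed_def partial_degree_add intro: le_trans trans_le_add1)

lemma var_ideal_power_prod_eq:
  fixes A :: "nat \<Rightarrow> 'n::finite set"
  assumes "\<And>i j. i \<in> {1..t} \<Longrightarrow> j \<in> {1..t} \<Longrightarrow> i \<noteq> j \<Longrightarrow> A i \<inter> A j = {}"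
  shows "var_ideal_power_prod t A a =
    (polys_on {u. \<forall>i\<in>{1..t}. a i \<le> partial_degree (A i) u} :: ('n, 'k::field) mpoly set)"
  using assms
proof (induction t)
  interpret S: comm_monoid "ideals_set (mpoly_ring :: ('n, 'k) mpoly ring)"
    by (rule cring.ideals_set_is_comm_monoid[OF cring_mpoly])
  case 0
  show ?case by (auto simp: var_ideal_power_prod_def polys_on_def)
next
  interpret S: comm_monoid "ideals_set (mpoly_ring :: ('n, 'k) mpoly ring)"
    by (rule cring.ideals_set_is_comm_monoid[OF cring_mpoly])
  case (Suc t)
  let ?U = "{u. \<forall>i\<in>{1..t}. a i \<le> partial_degree (A i) u}"
  let ?V = "{u. a (Suc t) \<le> partial_degree (A (Suc t)) u}"
  have set: "{1..Suc t} = insert (Suc t) {1..t}" by auto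
  have "(var_ideal_power_prod (Suc t) A a :: ('n, 'k) mpoly set) =
      order_ideal (A (Suc t)) (a (Suc t)) \<cdot>\<^bsub>mpoly_ring\<^esub> var_ideal_power_prod t A a"
    unfolding var_ideal_power_prod_def set
    by (subst S.finprod_insert) (auto simp: var_ideal_power ideal_order_ideal)
  also have "var_ideal_power_prod t A a = (polys_on ?U :: ('n, 'k) mpoly set)"
    using Suc.prems by (intro Suc.IH) auto
  also have "order_ideal (A (Suc t)) (a (Suc t)) = (polys_on ?V :: ('n, 'k) mpoly set)"
    by (simp add: order_ideal_def)
  also have "polys_on ?V \<cdot>\<^bsub>mpoly_ring\<^esub> polys_on ?U = (polys_on (?V \<inter> ?U) :: ('n, 'k) mpoly set)"
  proof (rule ideal_prod_disjoint[of _ "A (Suc t)" _ "\<Union>i\<in>{1..t}. A i"])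
    show "upclosed ?U" by (rule upclosed_order_constraints)
    show "depends_on ?V (A (Suc t))"
      unfolding depends_on_def using partial_degree_cong by (metis (no_types, lifting) mem_Collect_eq)
    show "depends_on ?U (\<Union>i\<in>{1..t}. A i)" by (rule depends_on_order_constraints)
    have "A (Suc t) \<inter> A i = {}" if "i \<in> {1..t}" for i using Suc.prems[of "Suc t" i] that by auto
    then show "A (Suc t) \<inter> (\<Union>i\<in>{1..t}. A i) = {}" by blast
  qed simp
  also have "?V \<inter> ?U = {u. \<forall>i\<in>{1..Suc t}. a i \<le> partial_degree (A i) u}" unfolding set by blast
  finally show ?case .
qed

lemma polys_on_order_constraints:
  "(polys_on {u. \<forall>i\<in>K. a i \<le> partial_degree (A i) u} :: ('n::finite, 'k::field) mpoly set) =
    (\<Inter>i\<in>K. order_ideal (A i) (a i))"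
  by (auto simp: order_ideal_def polys_on_def)

lemma depends_on_multiples:
  assumes "\<And>g i. g \<in> G \<Longrightarrow> i \<notin> A \<Longrightarrow> expo g i = 0"
  shows "depends_on (multiples G) A"
  unfolding depends_on_def
proof (intro ballI allI impI)
  fix u u' assume "u \<in> multiples G" and eq: "\<forall>i\<in>A. expo u' i = expo u i"
  then obtain g where g: "g \<in> G" "mono_dvd g u" by (auto simp: multiples_def)
  have "expo g i \<le> expo u' i" for i
    using g(2) eq assms[OF g(1), of i] by (cases "i \<in> A") (auto simp: mono_dvd_def)
  then show "u' \<in> multiples G" using g(1) by (auto simp: multiples_def mono_dvd_def)
qed

lemma var_ideal_power_prod_mult:
  fixes A :: "nat \<Rightarrow> 'n::finite set" and G :: "('n \<Rightarrow>\<^sub>0 nat) set"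
  assumes disjoint: "\<And>i j. i \<in> {1..t} \<Longrightarrow> j \<in> {1..t} \<Longrightarrow> i \<noteq> j \<Longrightarrow> A i \<inter> A j = {}"
    and G: "\<And>g i k. g \<in> G \<Longrightarrow> i \<in> {1..t} \<Longrightarrow> k \<in> A i \<Longrightarrow> expo g k = 0"
  shows "var_ideal_power_prod t A a \<cdot>\<^bsub>mpoly_ring\<^esub> polys_on (multiples G) =
    (polys_on ({u. \<forall>i\<in>{1..t}. a i \<le> partial_degree (A i) u} \<inter> multiples G) :: ('n, 'k::field) mpoly set)"
proof -
  have "polys_on {u. \<forall>i\<in>{1..t}. a i \<le> partial_degree (A i) u} \<cdot>\<^bsub>mpoly_ring\<^esub> polys_on (multiples G) =
    (polys_on ({u. \<forall>i\<in>{1..t}. a i \<le> partial_degree (A i) u} \<inter> multiples G) :: ('n, 'k) mpoly set)"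
  proof (rule ideal_prod_disjoint[OF upclosed_order_constraints depends_on_order_constraints upclosed_multiples])
    show "depends_on (multiples G) (- (\<Union>i\<in>{1..t}. A i))"
      using G by (intro depends_on_multiples) blast
  qed blast
  moreover have "var_ideal_power_prod t A a =
      (polys_on {u. \<forall>i\<in>{1..t}. a i \<le> partial_degree (A i) u} :: ('n, 'k) mpoly set)"
    using disjoint by (rule var_ideal_power_prod_eq)
  ultimately show ?thesis by (simp only:)
qed

section \<open>Unmixed polymatroidal ideals\<close>

lemma polymatroidal_min_gens:
  fixes I :: "('n::finite, 'k::field) mpoly set"
  assumes "polymatroidal d I"
  shows "polymatroid (min_gens I) d"
  using assms by unfold_locales (auto simp: polymatroidal_def)

lemma polymatroidal_eq:
  fixes I :: "('n::finite, 'k::field) mpoly set"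
  assumes "polymatroidal d I"
  shows "I = polys_on (multiples (min_gens I))"
  using assms monomial_ideal_min_gens by (auto simp: polymatroidal_def)

lemma matroidal_polys_on:
  fixes G :: "('n::finite \<Rightarrow>\<^sub>0 nat) set"
  assumes "antichain G" "polymatroid G e" "\<And>g i. g \<in> G \<Longrightarrow> expo g i \<le> 1"
  shows "matroidal e (polys_on (multiples G) :: ('n, 'k::field) mpoly set)"
proof -
  interpret polymatroid G e by fact
  have "monomial_ideal (polys_on (multiples G) :: ('n, 'k) mpoly set)"
    unfolding monomial_ideal_def using monomial_span_eq by metis
  then show ?thesis
    using assms(1,3) nonempty degree exchange
    by (simp add: matroidal_def polymatroidal_def min_gens_polys_on)
qed

text \<open>If \<open>u\<close> satisfies the constraints of all minimal covers but is not in the ideal, there is an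
associated prime, generated by \<open>A\<close>, of the form \<open>I : w\<close> with \<open>w\<close> above \<open>u\<close>. Equality of
heights makes \<open>A\<close> a minimal cover, and redistributing a base inside \<open>A\<close> then shows
that \<open>w\<close> lies in the ideal.\<close>

lemma unmixed_imp_saturated:
  assumes "polymatroid B d" and unmixed: "unmixed mpoly_ring (polys_on (multiples B) :: ('n::finite, 'k::field) mpoly set)"
  shows "saturated_polymatroid B d"
proof -
  interpret polymatroid B d by fact
  show ?thesis
  proof (unfold_locales, rule ccontr)
    fix u assume large: "\<And>C. min_cover B C \<Longrightarrow> order_along B C \<le> partial_degree C u"
      and "u \<notin> multiples B"
    then obtain A w where w: "mono_dvd u w" "w \<notin> multiples B" "\<And>i. i \<notin> A \<Longrightarrow> d \<le> expo w i"
      and A: "cover B A"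
        "(order_ideal A 1 :: ('n, 'k) mpoly set) \<in> associated_primes mpoly_ring (polys_on (multiples B))"
      using associated_prime_above[of B d u] expo_le by metis
    obtain C where C: "C \<subseteq> A" "min_cover B C" using cover_contains_min_cover[OF A(1)] .
    have "C = A"
    proof (rule ccontr)
      assume "C \<noteq> A"
      then have "(order_ideal C 1 :: ('n, 'k) mpoly set) \<subset> order_ideal A 1"
        using C by (intro order_ideal_psubset) blast
      then have "prime_height mpoly_ring (order_ideal C 1 :: ('n, 'k) mpoly set) <
          prime_height mpoly_ring (order_ideal A 1 :: ('n, 'k) mpoly set)"
        by (intro prime_height_strict_mono primeideal_order_ideal)
      moreover have "(order_ideal C 1 :: ('n, 'k) mpoly set) \<in> associated_primes mpoly_ring (polys_on (multiples B))"
        using min_cover_associated[of B d C] expo_le C by blast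
      ultimately show False
        using unmixed A(2) unfolding unmixed_def by (metis ideal_height_order_ideal less_irrefl)
    qed
    obtain v where v: "v \<in> B" "partial_degree A v = order_along B A"
      using order_along_attained[OF nonempty] .
    have min: "min_cover B A" using C(2) \<open>C = A\<close> by simp
    have le: "order_along B A \<le> partial_degree A w"
      using large[OF min] partial_degree_mono[OF w(1), of A] by simp
    obtain v' where v': "v' \<in> B" "\<And>i. i \<in> A \<Longrightarrow> expo v' i \<le> expo w i"
      "\<And>i. i \<notin> A \<Longrightarrow> expo v' i = expo v i"
      using redistribute_in_min_cover[OF min v le] by metis
    have "expo v' i \<le> expo w i" for i
      using v'(2)[of i] w(3)[of i] expo_le[OF v'(1), of i] by (cases "i \<in> A") auto
    then show False using v'(1) w(2) by (auto simp: multiples_def mono_dvd_def)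
  qed
qed

lemma associated_prime_contains:
  fixes I :: "('n, 'k::field) mpoly set"
  assumes "ideal I mpoly_ring" "P \<in> associated_primes mpoly_ring I"
  shows "primeideal P mpoly_ring" "I \<subseteq> P"
  using assms by (auto simp: associated_primes_eq colon_def ideal_mpoly_iff mult.commute)

text \<open>The height of \<open>J\<close> is a minimum over all primes above \<open>J\<close>; each of them contains a prime
belonging to a minimal cover, which is associated and so has the same height as \<open>P\<close>.\<close>

lemma height_associated_prime_unmixed:
  fixes J P :: "('n::finite, 'k::field) mpoly set"
  assumes J: "polymatroidal e J" "unmixed mpoly_ring J" and P: "P \<in> associated_primes mpoly_ring J"
  shows "ideal_height mpoly_ring P = ideal_height mpoly_ring J"
proof -
  interpret polymatroid "min_gens J" e using J(1) by (rule polymatroidal_min_gens)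
  have J_eq: "J = polys_on (multiples (min_gens J))" using J(1) by (rule polymatroidal_eq)
  have "ideal J mpoly_ring" by (subst J_eq) (intro ideal_polys_on upclosed_multiples)
  then have prime: "primeideal P mpoly_ring" and "J \<subseteq> P"
    using associated_prime_contains P by blast+
  have "prime_height mpoly_ring P = ideal_height mpoly_ring J"
    unfolding ideal_height_def[of _ J]
  proof (rule antisym)
    show "(INF P \<in> {P. primeideal P mpoly_ring \<and> J \<subseteq> P}. prime_height mpoly_ring P) \<le> prime_height mpoly_ring P"
      using prime \<open>J \<subseteq> P\<close> by (intro INF_lower) simp
    show "prime_height mpoly_ring P \<le> (INF P \<in> {P. primeideal P mpoly_ring \<and> J \<subseteq> P}. prime_height mpoly_ring P)"
    proof (rule INF_greatest, clarify)
      fix P' :: "('n, 'k) mpoly set" assume P': "primeideal P' mpoly_ring" "J \<subseteq> P'"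
      obtain C where C: "min_cover (min_gens J) C" "order_ideal C 1 \<subseteq> P'"
        using prime_contains_min_cover[OF P'(1)] P'(2) J_eq by metis
      then have "order_ideal C 1 \<in> associated_primes mpoly_ring J"
        using min_cover_associated[of "min_gens J" e C, where ?'k = 'k] expo_le J_eq by simp
      then have "ideal_height mpoly_ring P = ideal_height mpoly_ring (order_ideal C 1 :: ('n, 'k) mpoly set)"
        using J(2) P unfolding unmixed_def by blast
      then have "prime_height mpoly_ring P = prime_height mpoly_ring (order_ideal C 1 :: ('n, 'k) mpoly set)"
        using prime by (simp only: ideal_height_primeideal ideal_height_order_ideal)
      then show "prime_height mpoly_ring P \<le> prime_height mpoly_ring P'"
        using prime_height_mono[OF primeideal_order_ideal P'(1) C(2)] by simp
    qed
  qed
  then show ?thesis using prime by (simp add: ideal_height_primeideal)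
qed

lemma height_Inter_order_ideals:
  fixes L :: "'n::finite set set"
  assumes C0: "C0 \<in> L" and h: "\<And>C. C \<in> L \<Longrightarrow> ideal_height mpoly_ring (order_ideal C 1 :: ('n, 'k::field) mpoly set) = h"
  shows "ideal_height mpoly_ring (\<Inter>C\<in>L. order_ideal C 1 :: ('n, 'k) mpoly set) = h"
  unfolding ideal_height_def[of _ "\<Inter>C\<in>L. order_ideal C 1"]
proof (rule antisym)
  have h': "prime_height mpoly_ring (order_ideal C 1 :: ('n, 'k) mpoly set) = h" if "C \<in> L" for C
    using h[OF that] by (simp only: ideal_height_order_ideal)
  show "(INF P \<in> {P. primeideal P mpoly_ring \<and> (\<Inter>C\<in>L. order_ideal C 1 :: ('n, 'k) mpoly set) \<subseteq> P}.
      prime_height mpoly_ring P) \<le> h"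
    using C0 h'[OF C0] primeideal_order_ideal
    by (intro INF_lower2[of "order_ideal C0 1"]) auto
  show "h \<le> (INF P \<in> {P. primeideal P mpoly_ring \<and> (\<Inter>C\<in>L. order_ideal C 1 :: ('n, 'k) mpoly set) \<subseteq> P}.
      prime_height mpoly_ring P)"
  proof (rule INF_greatest, clarify)
    fix P :: "('n, 'k) mpoly set"
    assume P: "primeideal P mpoly_ring" "(\<Inter>C\<in>L. order_ideal C 1) \<subseteq> P"
    obtain C where C: "C \<in> L" "order_ideal C 1 \<subseteq> P"
      using prime_contains_finite_Inter[OF P(1) finite ideal_order_ideal P(2)] by blast
    then show "h \<le> prime_height mpoly_ring P"
      using prime_height_mono[OF primeideal_order_ideal P(1) C(2)] h' by simp
  qed
qed

text \<open>Only the generating primes of the intersected powers can be associated.\<close>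

lemma unmixed_Inter_order_ideals:
  fixes Q :: "'i \<Rightarrow> 'n::finite set"
  assumes K: "finite K" and h: "\<And>k. k \<in> K \<Longrightarrow> ideal_height mpoly_ring (order_ideal (Q k) 1 :: ('n, 'k::field) mpoly set) = h"
  shows "unmixed mpoly_ring (\<Inter>k\<in>K. order_ideal (Q k) (a k) :: ('n, 'k) mpoly set)"
proof -
  have "ideal_height mpoly_ring P = h"
    if P: "P \<in> associated_primes mpoly_ring (\<Inter>k\<in>K. order_ideal (Q k) (a k) :: ('n, 'k) mpoly set)" for P
  proof -
    obtain k where "k \<in> K" "P \<in> associated_primes mpoly_ring (order_ideal (Q k) (a k))"
      using associated_primes_finite_Inter[OF K ideal_order_ideal P] .
    then show ?thesis using associated_prime_order_ideal h by metis
  qed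
  then show ?thesis unfolding unmixed_def by simp
qed

lemma unmixed_Inter_order_ideals_Int:
  fixes Q :: "'i \<Rightarrow> 'n::finite set" and J :: "('n, 'k::field) mpoly set"
  assumes K: "finite K" and J: "polymatroidal e J" "unmixed mpoly_ring J"
    and h: "\<And>k. k \<in> K \<Longrightarrow> ideal_height mpoly_ring (order_ideal (Q k) 1 :: ('n, 'k::field) mpoly set)
      = ideal_height mpoly_ring J"
  shows "unmixed mpoly_ring ((\<Inter>k\<in>K. order_ideal (Q k) (a k)) \<inter> J)"
proof -
  \<comment> \<open>The index \<open>None\<close> stands for the additional ideal \<open>J\<close>.\<close>
  let ?R = "\<lambda>o'. case o' of None \<Rightarrow> J | Some k \<Rightarrow> order_ideal (Q k) (a k)"
  have "ideal J mpoly_ring"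
    by (subst polymatroidal_eq[OF J(1)]) (intro ideal_polys_on upclosed_multiples)
  then have ideals: "ideal (?R o') mpoly_ring" for o' using ideal_order_ideal by (cases o') auto
  have eq: "(\<Inter>k\<in>K. order_ideal (Q k) (a k)) \<inter> J = (\<Inter>o'\<in>insert None (Some ` K). ?R o')" by auto
  have "ideal_height mpoly_ring P = ideal_height mpoly_ring J"
    if P: "P \<in> associated_primes mpoly_ring (\<Inter>o'\<in>insert None (Some ` K). ?R o')" for P
  proof -
    obtain o' where "o' \<in> insert None (Some ` K)" "P \<in> associated_primes mpoly_ring (?R o')"
      using associated_primes_finite_Inter[OF _ ideals P] K by blast
    then show ?thesis
      using associated_prime_order_ideal[of P] h height_associated_prime_unmixed[OF J] by fastforce
  qed
  then show ?thesis unfolding unmixed_def eq by simp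
qed

section \<open>The classification\<close>

theorem theorem2:
  fixes I :: "('n::finite, 'k::field) mpoly set" and d :: nat
  assumes "polymatroidal d I"
    and "ideal_supp I = UNIV"
  shows "unmixed mpoly_ring I \<longleftrightarrow>
    I = var_ideal UNIV [^]\<^bsub>ideals_set mpoly_ring\<^esub> d
    \<or> (\<exists>t A a. 1 \<le> t \<and> (\<forall>i\<in>{1..t}. A i \<noteq> {} \<and> 1 \<le> a i) \<and>
         I = var_ideal_power_prod t A a \<and>
         (\<forall>i\<in>{1..t}. \<forall>j\<in>{1..t}. i \<noteq> j \<longrightarrow>
            ideal_height mpoly_ring (var_ideal (A i) :: ('n, 'k) mpoly set) =
              ideal_height mpoly_ring (var_ideal (A j) :: ('n, 'k) mpoly set) \<and>
            A i \<inter> A j = {}) \<and>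
         (\<Sum>i=1..t. a i) = d)
    \<or> (\<exists>t A a J e. 1 \<le> t \<and> (\<forall>i\<in>{1..t}. A i \<noteq> {} \<and> 1 \<le> a i) \<and>
         matroidal e J \<and> unmixed mpoly_ring J \<and>
         I = var_ideal_power_prod t A a \<cdot>\<^bsub>mpoly_ring\<^esub> J \<and>
         (\<forall>i\<in>{1..t}. ideal_height mpoly_ring (var_ideal (A i) :: ('n, 'k) mpoly set) =
            ideal_height mpoly_ring J) \<and>
         (\<forall>i\<in>{1..t}. \<forall>j\<in>{1..t}. i \<noteq> j \<longrightarrow> A i \<inter> A j = {}) \<and>
         (\<forall>i\<in>{1..t}. A i \<inter> ideal_supp J = {}) \<and>
         (\<Sum>i=1..t. a i) + e = d)
    \<or> (unmixed mpoly_ring I \<and> matroidal d I)"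
  (is "_ \<longleftrightarrow> ?c1 \<or> ?c2 \<or> ?c3 \<or> ?c4")
proof
  interpret polymatroid "min_gens I" d using assms(1) by (rule polymatroidal_min_gens)
  define B where "B = min_gens I"
  have I_eq: "I = polys_on (multiples B)" unfolding B_def using assms(1) by (rule polymatroidal_eq)
  assume unm: "unmixed mpoly_ring I"
  interpret saturated_polymatroid B d
    using unmixed_imp_saturated[of B d] polymatroid_axioms unm I_eq B_def by metis
  define H where "H = {C. min_cover B C \<and> 2 \<le> order_along B C}"
  define L where "L = {C. min_cover B C \<and> \<not> 2 \<le> order_along B C}"
  obtain G e where G: "antichain G" "polymatroid G e"
    "multiples G = {u. \<forall>C\<in>L. 0 < partial_degree C u}"
    "\<forall>g\<in>G. \<forall>i. expo g i \<le> 1" "\<forall>g\<in>G. \<forall>i\<in>\<Union>H. expo g i = 0"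
    "(\<Sum>C\<in>H. order_along B C) + e = d"
    by (rule split_off_heavy[OF H_def L_def])
  define J where "J = (polys_on (multiples G) :: ('n, 'k) mpoly set)"
  have gens_J: "min_gens J = G" unfolding J_def using G(1) by (rule min_gens_polys_on)
  have J: "matroidal e J" unfolding J_def using G(1,2,4) by (intro matroidal_polys_on) auto
  have J_Inter: "J = (\<Inter>C\<in>L. order_ideal C 1)"
    unfolding J_def G(3) by (auto simp: order_ideal_def polys_on_def subset_iff Suc_le_eq)
  have pos: "1 \<le> order_along B C" if "min_cover B C" for C
    using that order_along_pos[OF nonempty, of C] by (simp add: min_cover_def B_def)
  have mults: "multiples B = {u. \<forall>C\<in>H. order_along B C \<le> partial_degree C u} \<inter> multiples G"
  proof -
    have "order_along B C \<le> partial_degree C u \<longleftrightarrow> 0 < partial_degree C u" if "C \<in> L" for C u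
    proof -
      have "order_along B C = 1" using that pos[of C] by (auto simp: L_def)
      then show ?thesis by auto
    qed
    moreover have "min_cover B C \<longleftrightarrow> C \<in> H \<or> C \<in> L" for C by (auto simp: H_def L_def)
    ultimately show ?thesis unfolding multiples_eq G(3) by blast
  qed
  have assoc: "(order_ideal C 1 :: ('n, 'k) mpoly set) \<in> associated_primes mpoly_ring I" if "min_cover B C" for C
    using min_cover_associated[of B d C] that expo_le I_eq by metis
  then have heights: "ideal_height mpoly_ring (order_ideal C 1 :: ('n, 'k) mpoly set) =
      ideal_height mpoly_ring (order_ideal C' 1 :: ('n, 'k) mpoly set)"
    if "min_cover B C" "min_cover B C'" for C C'
    using unm that unfolding unmixed_def by blast
  have nonempty_cover: "C \<noteq> {}" if "min_cover B C" for C
    using that nonempty by (auto simp: B_def min_cover_def cover_def partial_degree_def)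
  show "?c1 \<or> ?c2 \<or> ?c3 \<or> ?c4"
  proof (cases "H = {}")
    case True
    then have "I = J" "e = d" using mults I_eq J_def G(6) by auto
    then show ?thesis using unm J by blast
  next
    case False
    define t where "t = card H"
    obtain A where A: "bij_betw A {1..t} H"
      using ex_bij_betw_nat_finite_1[of H] t_def by auto
    define a where "a i = order_along B (A i)" for i
    have "1 \<le> t" using False by (simp add: t_def Suc_le_eq card_gt_0_iff)
    have A_H: "A i \<in> H" if "i \<in> {1..t}" for i using A that by (rule bij_betwE[THEN bspec])
    have A_cover: "min_cover B (A i)" if "i \<in> {1..t}" for i using A_H[OF that] by (simp add: H_def)
    have A_pos: "\<forall>i\<in>{1..t}. A i \<noteq> {} \<and> 1 \<le> a i"
      using A_cover nonempty_cover pos by (simp add: a_def)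
    have A_disjoint: "A i \<inter> A j = {}" if "i \<in> {1..t}" "j \<in> {1..t}" "i \<noteq> j" for i j
    proof -
      have "inj_on A {1..t}" using A by (rule bij_betw_imp_inj_on)
      then have "A j \<noteq> A i" using inj_on_eq_iff[of A "{1..t}" i j] that by simp
      then show ?thesis
        using heavy_min_cover_disjoint[of "A i" "A j"] A_H[OF that(1)] A_cover[OF that(2)] by (simp add: H_def)
    qed
    have sum_a: "(\<Sum>i=1..t. a i) = (\<Sum>C\<in>H. order_along B C)"
      unfolding a_def using sum.reindex_bij_betw[OF A] .
    have U_eq: "{u. \<forall>C\<in>H. order_along B C \<le> partial_degree C u} = {u. \<forall>i\<in>{1..t}. a i \<le> partial_degree (A i) u}"
      using A by (auto simp: bij_betw_def a_def)
    have prod_eq: "var_ideal_power_prod t A a =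
        (polys_on {u. \<forall>i\<in>{1..t}. a i \<le> partial_degree (A i) u} :: ('n, 'k) mpoly set)"
      using A_disjoint by (rule var_ideal_power_prod_eq)
    show ?thesis
    proof (cases "L = {}")
      case True
      have "?c2"
      proof (intro exI[of _ t] exI[of _ A] exI[of _ a] conjI)
        have UNIV: "multiples G = UNIV" using True G(3) by simp
        then show "I = var_ideal_power_prod t A a" using I_eq mults prod_eq U_eq by simp
        have "0 \<in> multiples G" using UNIV by simp
        then obtain g where g: "g \<in> G" "mono_dvd g 0" by (auto simp: multiples_def)
        then have "mono_degree g = 0" using mono_dvd_degree_le[OF g(2)] by (simp add: mono_degree_def)
        then have "e = 0" using polymatroid.degree[OF G(2) g(1)] by simp
        then show "(\<Sum>i=1..t. a i) = d" using G(6) sum_a by simp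
        show "\<forall>i\<in>{1..t}. \<forall>j\<in>{1..t}. i \<noteq> j \<longrightarrow>
            ideal_height mpoly_ring (var_ideal (A i) :: ('n, 'k) mpoly set) =
              ideal_height mpoly_ring (var_ideal (A j) :: ('n, 'k) mpoly set) \<and> A i \<inter> A j = {}"
          using A_disjoint heights A_cover by (simp add: var_ideal_eq)
      qed (use \<open>1 \<le> t\<close> A_pos in auto)
      then show ?thesis by blast
    next
      case False
      then obtain C0 where C0: "C0 \<in> L" by blast
      define h where "h = ideal_height mpoly_ring (order_ideal C0 1 :: ('n, 'k) mpoly set)"
      have h: "ideal_height mpoly_ring (order_ideal C 1 :: ('n, 'k) mpoly set) = h" if "min_cover B C" for C
      proof -
        have "min_cover B C0" using C0 by (simp add: L_def)
        then show ?thesis unfolding h_def using that by (intro heights)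
      qed
      have h_L: "ideal_height mpoly_ring (order_ideal C 1 :: ('n, 'k) mpoly set) = h" if "C \<in> L" for C
      proof (rule h)
        show "min_cover B C" using that by (simp add: L_def)
      qed
      have height_J: "ideal_height mpoly_ring J = h"
        unfolding J_Inter using C0 h_L by (rule height_Inter_order_ideals)
      have unmixed_J: "unmixed mpoly_ring J"
        unfolding J_Inter using finite h_L by (rule unmixed_Inter_order_ideals)
      have supp_J: "A i \<inter> ideal_supp J = {}" if "i \<in> {1..t}" for i
        using G(5) A_H[OF that] by (fastforce simp: ideal_supp_def gens_J)
      have prod_J: "var_ideal_power_prod t A a \<cdot>\<^bsub>mpoly_ring\<^esub> J = I"
        unfolding J_def I_eq mults U_eq
        using A_disjoint G(5) A_H by (intro var_ideal_power_prod_mult) blast+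
      have "?c3"
      proof (rule exI[of _ t], rule exI[of _ A], rule exI[of _ a], rule exI[of _ J], rule exI[of _ e], intro conjI)
        show "\<forall>i\<in>{1..t}. ideal_height mpoly_ring (var_ideal (A i) :: ('n, 'k) mpoly set) =
            ideal_height mpoly_ring J"
          using h A_cover height_J by (simp add: var_ideal_eq)
        show "I = var_ideal_power_prod t A a \<cdot>\<^bsub>mpoly_ring\<^esub> J" using prod_J by simp
        show "(\<Sum>i=1..t. a i) + e = d" using G(6) sum_a by simp
      qed (use \<open>1 \<le> t\<close> A_pos J unmixed_J A_disjoint supp_J in auto)
      then show ?thesis by blast
    qed
  qed
next
  have product_unmixed: "unmixed mpoly_ring I"
    if t: "1 \<le> t" and I: "I = var_ideal_power_prod t A a"
      and A: "\<forall>i\<in>{1..t}. \<forall>j\<in>{1..t}. i \<noteq> j \<longrightarrow>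
            ideal_height mpoly_ring (var_ideal (A i) :: ('n, 'k) mpoly set) =
              ideal_height mpoly_ring (var_ideal (A j) :: ('n, 'k) mpoly set) \<and> A i \<inter> A j = {}"
    for t A a
  proof -
    have eq: "I = (\<Inter>i\<in>{1..t}. order_ideal (A i) (a i))"
      unfolding I polys_on_order_constraints[symmetric] using A by (intro var_ideal_power_prod_eq) blast
    have "ideal_height mpoly_ring (order_ideal (A i) 1 :: ('n, 'k) mpoly set) =
        ideal_height mpoly_ring (order_ideal (A 1) 1 :: ('n, 'k) mpoly set)" if "i \<in> {1..t}" for i
      using A that t by (cases "i = 1") (auto simp: var_ideal_eq)
    then show ?thesis unfolding eq by (rule unmixed_Inter_order_ideals[OF finite_atLeastAtMost])
  qed
  have product_mult_unmixed: "unmixed mpoly_ring I"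
    if J: "matroidal e J" "unmixed mpoly_ring J"
      and I: "I = var_ideal_power_prod t A a \<cdot>\<^bsub>mpoly_ring\<^esub> J"
      and h: "\<forall>i\<in>{1..t}. ideal_height mpoly_ring (var_ideal (A i) :: ('n, 'k) mpoly set) = ideal_height mpoly_ring J"
      and A: "\<forall>i\<in>{1..t}. \<forall>j\<in>{1..t}. i \<noteq> j \<longrightarrow> A i \<inter> A j = {}"
        "\<forall>i\<in>{1..t}. A i \<inter> ideal_supp J = {}"
    for t A a J e
  proof -
    have poly: "polymatroidal e J" using J(1) by (simp add: matroidal_def)
    have J_eq: "J = polys_on (multiples (min_gens J))" using poly by (rule polymatroidal_eq)
    have off: "expo g k = 0" if "g \<in> min_gens J" "i \<in> {1..t}" "k \<in> A i" for g i k
    proof -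
      have "k \<notin> ideal_supp J" using A(2) that(2,3) by blast
      then show ?thesis using that(1) by (auto simp: ideal_supp_def)
    qed
    have "I = polys_on ({u. \<forall>i\<in>{1..t}. a i \<le> partial_degree (A i) u} \<inter> multiples (min_gens J))"
      unfolding I by (subst J_eq, rule var_ideal_power_prod_mult) (use A(1) off in blast)+
    also have "\<dots> = (\<Inter>i\<in>{1..t}. order_ideal (A i) (a i)) \<inter> J"
      using J_eq by (simp add: polys_on_Int polys_on_order_constraints)
    finally show ?thesis
      using unmixed_Inter_order_ideals_Int[of "{1..t}" e J A a] poly J(2) h by (simp add: var_ideal_eq)
  qed
  assume "?c1 \<or> ?c2 \<or> ?c3 \<or> ?c4"
  then show "unmixed mpoly_ring I"
  proof (elim disjE)
    assume ?c1
    then have "I = (\<Inter>k\<in>{()}. order_ideal UNIV d)" by (simp add: var_ideal_power)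
    then show ?thesis using unmixed_Inter_order_ideals[of "{()}" "\<lambda>_. UNIV" _ "\<lambda>_. d"] by simp
  next
    assume ?c2
    then show ?thesis using product_unmixed by (elim exE conjE)
  next
    assume ?c3
    then show ?thesis using product_mult_unmixed by (elim exE conjE)
  qed simp
qed

end
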